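(* For each $n\ge2$ let $\pi_n$ be uniformly distributed on $\mathcal{S}_n$, and let $D_n=D(\pi_n)$, $D'_n=D(\pi_n^{-1})$. For any $x,y\in\,]1/2,1[$, as $n\to\infty$, $$\mathbb{P}\Big(\frac{D_n}{n-1}\ge x,\ \frac{D'_n}{n-1}\ge y\Big)=\frac{\exp(-nI(x,y)+\varphi_n(x,y))}{2\pi n\,\sigma_xt_x\sigma_yt_y}\big[1+o(1)\big],$$ $$\mathbb{P}\Big(\frac{D_n}{n-1}\le 1-x,\ \frac{D'_n}{n-1}\le 1-y\Big)=\frac{\exp(-nI(x,y)+\varphi_n(x,y))}{2\pi n\,\sigma_xt_x\sigma_yt_y}\big[1+o(1)\big],$$ $$\mathbb{P}\Big(\frac{D_n}{n-1}\le 1-x,\ \frac{D'_n}{n-1}\ge y\Big)=\frac{\exp(-nI(x,y)+\phi_n(x,y))}{2\pi n\,\sigma_xt_x\sigma_yt_y}\big[1+o(1)\big],$$ $$\mathbb{P}\Big(\frac{D_n}{n-1}\ge x,\ \frac{D'_n}{n-1}\le 1-y\Big)=\frac{\exp(-nI(x,y)+\phi_n(x,y))}{2\pi n\,\sigma_xt_x\sigma_yt_y}\big[1+o(1)\big],$$ where $\varphi_n(x,y)=\{x_n\}t_x+\{y_n\}t_y+\frac12t_xt_y$ and $\phi_n(x,y)=\{x_n\}t_x+\{y_n\}t_y-\frac12t_xt_y$.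
   Context: $\mathcal{S}_n$ is the symmetric group on $\{1,\dots,n\}$; for $\sigma\in\mathcal{S}_n$, $D(\sigma)=\#\{i\le n-1:\sigma(i)>\sigma(i+1)\}$. $L(t)=\log\big((e^t-1)/t\big)$ (with $L(0)=0$), $I(x)=\sup_{t\in\mathbb{R}}\{xt-L(t)\}$, $I(x,y)=I(x)+I(y)$. For $x\in\,]0,1[$, $t_x$ is the unique real solution of $L'(t_x)=x$ (so $t_x>0$ for $x>1/2$) and $\sigma_x^2=L''(t_x)$ with $\sigma_x>0$. For $x>0$ and $n\ge1$, $\{x_n\}=nx-\lceil (n-1)x\rceil$. *)

theory Defs
  imports
    "HOL-Probability.Probability"
    "HOL-Combinatorics.Permutations"
    "HOL-Library.Landau_Symbols"
begin

text \<open>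
  A permutation in \<open>S\<^sub>n\<close> is a function \<open>\<sigma> :: nat \<Rightarrow> nat\<close> with \<open>\<sigma> permutes {1..n}\<close>;
  it is the identity outside \<open>{1..n}\<close>, so \<open>inv \<sigma>\<close> is the inverse in \<open>S\<^sub>n\<close>.
\<close>

definition descents :: "nat \<Rightarrow> (nat \<Rightarrow> nat) \<Rightarrow> nat" where
  "descents n \<sigma> = card {i \<in> {1..<n}. \<sigma> i > \<sigma> (i + 1)}"

definition uniform_perm :: "nat \<Rightarrow> (nat \<Rightarrow> nat) pmf" where
  "uniform_perm n = pmf_of_set {\<sigma>. \<sigma> permutes {1..n}}"

definition log_laplace :: "real \<Rightarrow> real" where
  "log_laplace t = (if t = 0 then 0 else ln ((exp t - 1) / t))"

text \<open>
  The supremum is taken in the reals. For \<open>0 < x < 1\<close> the set is bounded above, so this is the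
  genuine supremum; for \<open>x \<le> 0\<close> or \<open>x \<ge> 1\<close>, where the rate function is infinite, the value is
  meaningless.
\<close>

definition rate :: "real \<Rightarrow> real" where
  "rate x = (SUP t. x * t - log_laplace t)"

definition rate2 :: "real \<Rightarrow> real \<Rightarrow> real" where
  "rate2 x y = rate x + rate y"

text \<open>The solution exists and is unique for \<open>0 < x < 1\<close>.\<close>

definition tilt :: "real \<Rightarrow> real" where
  "tilt x = (THE t. deriv log_laplace t = x)"

definition tilt_sd :: "real \<Rightarrow> real" where
  "tilt_sd x = sqrt (deriv (deriv log_laplace) (tilt x))"

text \<open>
  The quantity \<open>{x\<^sub>n}\<close>; it is not the fractional part of \<open>n x\<close>.
\<close>

definition offset :: "nat \<Rightarrow> real \<Rightarrow> real" where
  "offset n x = real n * x - of_int \<lceil>(real n - 1) * x\<rceil>"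

definition corr_pos :: "nat \<Rightarrow> real \<Rightarrow> real \<Rightarrow> real" where
  "corr_pos n x y = offset n x * tilt x + offset n y * tilt y + tilt x * tilt y / 2"

definition corr_neg :: "nat \<Rightarrow> real \<Rightarrow> real \<Rightarrow> real" where
  "corr_neg n x y = offset n x * tilt x + offset n y * tilt y - tilt x * tilt y / 2"

unbundle asymp_equiv_syntax

end

theory Submission
  imports
    Defs
    "HOL-Combinatorics.Stirling"
    "HOL-Complex_Analysis.Complex_Analysis"
    "HOL-Real_Asymp.Real_Asymp"
begin

text \<open>
  Inverting the identity of Carlitz, Roselle and Scoville
  \<open>(k * l + n - 1 choose n) = (\<Sum>\<sigma>. (k - D \<sigma> + n - 1 choose n) * (l - D (inv \<sigma>) + n - 1 choose n))\<close>
  and expanding the left-hand side in powers of \<open>k * l\<close> expresses the joint distribution of the two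
  descent numbers through derivatives of the distribution function \<open>F\<^sub>n\<close> of a sum of \<open>n\<close>
  independent uniform variables: \<open>P(D\<^sub>n < a, D'\<^sub>n < b)\<close> is the sum over \<open>j < n\<close> of
  \<open>F\<^sub>n\<^sup>(\<^sup>j\<^sup>)(a) F\<^sub>n\<^sup>(\<^sup>j\<^sup>)(b)\<close> weighted by \<open>stirling n (n - j) * ((n - j)! / n!)\<^sup>2\<close>, and complementary tails only
  introduce signs. The saddle point method on the line \<open>Re z = t\<^sub>x\<close> shows that each derivative of
  the tail function multiplies it asymptotically by \<open>t\<^sub>x\<close> up to sign, and the weights tend to
  \<open>1 / (2\<^sup>j j!)\<close>. By dominated convergence the series contributes
  \<open>exp (t\<^sub>x t\<^sub>y / 2)\<close> or \<open>exp (- t\<^sub>x t\<^sub>y / 2)\<close>, which is the correlation term of the theorem.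
\<close>

subsection \<open>Descents of a permutation and its inverse\<close>

text \<open>The factor 1/2 in the exponent comes from Stirling numbers close to the diagonal: for
  fixed j, a permutation of n points with n - j cycles is typically a product of j disjoint
  transpositions, so there are about n^(2j) / (2^j j!) of them. The obstacle is that the series has
  n terms while the saddle point limit is available only for each fixed j. The estimates must
  therefore be uniform in j < n, including the last terms, where differentiation has cancelled
  almost all powers of 1/z in the integrand. What saves them is that exp z - 1 is bounded on the
  line: each power of z gained by differentiating is paid for by one factor of a characteristic
  function, and at least two factors are left to make the integral converge. The loss is geometric
  in j, while the weights retain 1/j!. All four events are reduced to the same values
  \<open>irwin_hall n m (n - a)\<close> by symmetry, so that a contour with positive real part
  serves upper and lower tails alike.\<close>

definition ascending :: "nat \<Rightarrow> nat \<Rightarrow> nat set \<Rightarrow> (nat \<Rightarrow> nat) set" where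
  "ascending n k S = {u \<in> {1..n} \<rightarrow>\<^sub>E {..<k}.
     \<forall>i\<in>{1..<n}. u i \<le> u (i + 1) \<and> (i \<in> S \<longrightarrow> u i < u (i + 1))}"

lemma ascendingD:
  assumes "u \<in> ascending n k S"
  shows "i \<in> {1..n} \<Longrightarrow> u i < k" "i \<in> {1..<n} \<Longrightarrow> u i \<le> u (i + 1)"
    "i \<in> {1..<n} \<Longrightarrow> i \<in> S \<Longrightarrow> u i < u (i + 1)" "i \<notin> {1..n} \<Longrightarrow> u i = undefined"
  using assms unfolding ascending_def by (auto simp: PiE_iff extensional_def Pi_iff)

lemma ascending_mono:
  assumes "u \<in> ascending n k S" "1 \<le> i" "i \<le> j" "j \<le> n"
  shows "u i \<le> u j"
  using assms(3,4)
proof (induction j rule: dec_induct)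
  case (step j)
  then show ?case using ascendingD(2)[OF assms(1), of j] assms(2) by fastforce
qed simp

lemma finite_ascending [simp]: "finite (ascending n k S)"
  unfolding ascending_def by (rule finite_subset[of _ "{1..n} \<rightarrow>\<^sub>E {..<k}"]) (auto intro: finite_PiE)

text \<open>The word is increasing, so the condition between places n and n + 1 is a bound on the
  alphabet of the initial word: letters below v if an ascent is forced there, at most v
  otherwise.\<close>

lemma ascending_Suc:
  assumes "n \<ge> 1"
  shows "ascending (Suc n) k S =
    (\<Union>v\<in>{..<k}. (\<lambda>u. u(Suc n := v)) ` ascending n (if n \<in> S then v else Suc v) S)"
proof (intro set_eqI iffI)
  fix w assume w: "w \<in> ascending (Suc n) k S"
  let ?v = "w (Suc n)" and ?u = "restrict w {1..n}"
  have wn: "w i \<le> w n" if "i \<in> {1..n}" for i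
    using ascending_mono[OF w, of i n] that assms by auto
  have "w n \<le> ?v" "n \<in> S \<Longrightarrow> w n < ?v"
    using ascendingD(2,3)[OF w, of n] assms by auto
  hence "?u \<in> ascending n (if n \<in> S then ?v else Suc ?v) S"
    using w wn unfolding ascending_def by (force simp: PiE_iff Pi_iff extensional_def)
  moreover have "w = ?u(Suc n := ?v)"
    using ascendingD(4)[OF w] by (auto simp: fun_eq_iff restrict_def)
  moreover have "?v < k" using ascendingD(1)[OF w] by auto
  ultimately show "w \<in> (\<Union>v\<in>{..<k}. (\<lambda>u. u(Suc n := v)) ` ascending n (if n \<in> S then v else Suc v) S)"
    by blast
next
  fix w assume "w \<in> (\<Union>v\<in>{..<k}. (\<lambda>u. u(Suc n := v)) ` ascending n (if n \<in> S then v else Suc v) S)"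
  then obtain u v where v: "v < k" and u: "u \<in> ascending n (if n \<in> S then v else Suc v) S"
    and w: "w = u(Suc n := v)" by auto
  have "u n < (if n \<in> S then v else Suc v)" using ascendingD(1)[OF u, of n] assms by auto
  then have "u n \<le> v" "n \<in> S \<Longrightarrow> u n < v" by (auto split: if_splits)
  moreover have "u i < k" if "i \<in> {1..n}" for i
    using ascendingD(1)[OF u that] v by (auto split: if_splits)
  ultimately show "w \<in> ascending (Suc n) k S"
    using u v assms unfolding ascending_def w
    by (auto simp: PiE_iff Pi_iff extensional_def less_Suc_eq)
qed

text \<open>Hockey-stick summation. For \<open>Suc v \<le> d\<close> truncated subtraction leaves n
  - 1 choose n, which is 0, so the sum effectively starts at v = d.\<close>

lemma sum_choose_shift:
  assumes "n \<ge> 1"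
  shows "(\<Sum>v<k. (Suc v - d + n - 1) choose n) = (k - d + n) choose (Suc n)"
proof (induction k)
  case (Suc k)
  then show ?case using assms by (cases "d \<le> k") (auto simp: Suc_diff_le)
qed simp

text \<open>Subtracting from each letter the number of forced ascents before it leaves a weakly
  increasing word over k - d letters, d being the number of forced ascents; so only d matters. For d
  \<ge> k truncated subtraction yields the correct count 0. The proof removes the last letter
  instead.\<close>

lemma card_ascending:
  assumes "n \<ge> 1"
  shows "card (ascending n k S) = (k - card (S \<inter> {1..<n}) + n - 1) choose n"
  using assms
proof (induction n arbitrary: k rule: dec_induct)
  case base
  have "ascending 1 k S = {1..1} \<rightarrow>\<^sub>E {..<k}" unfolding ascending_def by auto
  then show ?case by (simp add: card_PiE)
next
  case (step n)
  define d where "d = card (S \<inter> {1..<n})"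
  have ex: "u (Suc n) = undefined" if "u \<in> ascending n k' S" for u k'
    using ascendingD(4)[OF that] by simp
  have inj: "inj_on (\<lambda>u. u(Suc n := v)) (ascending n k' S)" for v k'
    by (rule inj_onI) (metis ex fun_upd_triv fun_upd_upd)
  have "card (ascending (Suc n) k S) =
      (\<Sum>v<k. card ((\<lambda>u. u(Suc n := v)) ` ascending n (if n \<in> S then v else Suc v) S))"
    unfolding ascending_Suc[OF step.hyps(1)]
    by (rule card_UN_disjoint) (auto dest: fun_upd_eqD)
  also have "\<dots> = (\<Sum>v<k. ((if n \<in> S then v else Suc v) - d + n - 1) choose n)"
    by (intro sum.cong refl) (simp add: card_image[OF inj] step.IH d_def)
  also have "\<dots> = (k - (if n \<in> S then Suc d else d) + n) choose (Suc n)"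
  proof (cases "n \<in> S")
    case True
    show ?thesis using sum_choose_shift[of n "Suc d" k] True step.hyps by simp
  next
    case False
    show ?thesis using sum_choose_shift[of n d k] False step.hyps by simp
  qed
  also have "(if n \<in> S then Suc d else d) = card (S \<inter> {1..<Suc n})"
  proof -
    have "{1..<Suc n} = insert n {1..<n}" using step.hyps(1) by auto
    then show ?thesis by (auto simp: d_def Int_insert_right)
  qed
  finally show ?case by simp
qed

definition Des :: "nat \<Rightarrow> (nat \<Rightarrow> nat) \<Rightarrow> nat set" where
  "Des n \<sigma> = {i \<in> {1..<n}. \<sigma> i > \<sigma> (i + 1)}"

lemma card_ascending_Des:
  "n \<ge> 1 \<Longrightarrow> card (ascending n k (Des n \<sigma>)) = (k - descents n \<sigma> + n - 1) choose n"
  using card_ascending[of n k "Des n \<sigma>"] by (simp add: Des_def descents_def Int_def conj_commute cong: conj_cong)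

section \<open>Inversion of the binomial kernel\<close>

lemma fps_one_minus_X_power_nth:
  "fps_nth ((1 - fps_X) ^ n :: real fps) i = (-1) ^ i * of_nat (n choose i)"
proof (induction n arbitrary: i)
  case (Suc n)
  show ?case
    by (cases i) (simp_all add: Suc.IH power_Suc algebra_simps  del: power_Suc add: power_Suc2)
qed (simp add: fps_one_nth)

text \<open>The second factor is 1 / (1 - X)^(n+1), so the product is the geometric series.\<close>

lemma fps_choose_mult:
  "(1 - fps_X) ^ n * Abs_fps (\<lambda>r. real ((r + n) choose n)) = Abs_fps (\<lambda>_. 1)"
proof (induction n)
  case (Suc n)
  have "(1 - fps_X) * Abs_fps (\<lambda>r. real ((r + Suc n) choose Suc n)) = Abs_fps (\<lambda>r. real ((r + n) choose n))"
  proof (rule fps_ext)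
    fix r show "fps_nth ((1 - fps_X) * Abs_fps (\<lambda>r. real ((r + Suc n) choose Suc n))) r = fps_nth (Abs_fps (\<lambda>r. real ((r + n) choose n))) r"
      by (cases r) (simp_all add: algebra_simps)
  qed
  then show ?case using Suc by (simp add: mult.assoc power_Suc2 del: power_Suc)
qed simp

text \<open>The generating series in k of the last binomial is X^(d+1) / (1 - X)^(n+1). Multiplying
  by (1 - X)^n leaves X^(d+1) / (1 - X), whose coefficient at X^a is the indicator of d < a. The
  power n, instead of n + 1, produces distribution functions rather than point masses.\<close>

lemma alternating_choose:
  assumes "n \<ge> 1"
  shows "(\<Sum>k\<le>a. (-1) ^ (a - k) * real (n choose (a - k)) * real ((k - d + n - 1) choose n)) = of_bool (d < a)"
proof -
  have z: "real ((k - d + n - 1) choose n) = 0" if "k \<le> d" for k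
    using that assms by simp
  show ?thesis
  proof (cases "d < a")
    case False
    then show ?thesis using z 
      by (intro sum.neutral[THEN trans]) auto
  next
    case True
    define r where "r = a - Suc d"
    have a: "a = r + Suc d" using True r_def by simp
    have "(\<Sum>k\<le>a. (-1) ^ (a - k) * real (n choose (a - k)) * real ((k - d + n - 1) choose n))
      = (\<Sum>k\<in>{Suc d..a}. (-1) ^ (a - k) * real (n choose (a - k)) * real ((k - d + n - 1) choose n))"
      using z by (intro sum.mono_neutral_right) (auto simp: not_less_eq_eq)
    also have "\<dots> = (\<Sum>i=0..r. (-1) ^ i * real (n choose i) * real ((r - i + n) choose n))"
      by (rule sum.reindex_bij_witness[of _ "\<lambda>i. a - i" "\<lambda>k. a - k"]) (auto simp: a Suc_diff_le)
    also have "\<dots> = fps_nth ((1 - fps_X) ^ n * Abs_fps (\<lambda>r. real ((r + n) choose n))) r"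
      by (simp add: fps_mult_nth fps_one_minus_X_power_nth)
    finally show ?thesis using True by (simp add: fps_choose_mult)
  qed
qed

section \<open>Stable sorting and the bijection behind the two-variable identity\<close>

lemma ascending_fibre_increasing:
  assumes u: "u \<in> ascending n k (Des n \<tau>)" and "1 \<le> i" "i \<le> j" "j \<le> n" "u i = u j" and t: "inj_on \<tau> {1..n}"
  shows "\<tau> i \<le> \<tau> j"
  using assms(3-5)
proof (induction j rule: dec_induct)
  case (step j)
  have "u i \<le> u j" "u j \<le> u (Suc j)"
    using ascending_mono[OF u, of i j] ascending_mono[OF u, of j "Suc j"] assms(2) step by auto
  then have eq: "u i = u j" "u j = u (Suc j)" using step.prems by auto
  \<comment> \<open>Strictness at descents forbids a descent where the word stays constant.\<close>
  have "j \<notin> Des n \<tau>"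
    using ascendingD(3)[OF u, of j] eq(2) assms(2) step by auto
  then have "\<tau> j \<le> \<tau> (Suc j)" using assms(2) step by (auto simp: Des_def)
  then show ?case using step eq by auto
qed simp

definition stable_less :: "(nat \<Rightarrow> nat) \<Rightarrow> nat \<Rightarrow> nat \<Rightarrow> bool" where
  "stable_less v m m' \<longleftrightarrow> v m < v m' \<or> v m = v m' \<and> m < m'"

text \<open>This recovers \<sigma> from the remainders \<open>p \<circ> \<sigma>\<close> alone,
  hence gives injectivity: p is weakly increasing, and its strictness at the descents of
  \<open>inv \<sigma>\<close> forces ties to be ordered by position.\<close>

lemma permutation_less_iff_stable_less:
  assumes s: "\<sigma> permutes {1..n}" and p: "p \<in> ascending n l (Des n (inv \<sigma>))"
    and m: "m \<in> {1..n}" "m' \<in> {1..n}"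
  shows "\<sigma> m < \<sigma> m' \<longleftrightarrow> stable_less (p \<circ> \<sigma>) m m'"
proof -
  have *: "stable_less (p \<circ> \<sigma>) m m'" if "\<sigma> m < \<sigma> m'" "m \<in> {1..n}" "m' \<in> {1..n}" for m m'
  proof -
    have r: "\<sigma> m \<in> {1..n}" "\<sigma> m' \<in> {1..n}"
      using that permutes_in_image[OF s] by auto
    have le: "p (\<sigma> m) \<le> p (\<sigma> m')" using ascending_mono[OF p, of "\<sigma> m" "\<sigma> m'"] r that by auto
    have "m \<le> m'" if "p (\<sigma> m) = p (\<sigma> m')"
      using ascending_fibre_increasing[OF p, of "\<sigma> m" "\<sigma> m'"] that r \<open>\<sigma> m < \<sigma> m'\<close>
        permutes_inverses(2)[OF s] permutes_inj_on[OF permutes_inv[OF s]] by auto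
    moreover have "m \<noteq> m'" using that by auto
    ultimately show ?thesis using le by (auto simp: stable_less_def)
  qed
  show ?thesis
  proof
    assume sl: "stable_less (p \<circ> \<sigma>) m m'"
    show "\<sigma> m < \<sigma> m'"
    proof (rule ccontr)
      assume "\<not> \<sigma> m < \<sigma> m'"
      moreover have "\<sigma> m \<noteq> \<sigma> m'"
        using sl permutes_inj[OF s] by (auto simp: stable_less_def inj_eq)
      ultimately have "\<sigma> m' < \<sigma> m" by simp
      from *[OF this m(2,1)] sl show False by (auto simp: stable_less_def)
    qed
  qed (use * m in blast)
qed

text \<open>Each value of a permutation is its rank, one more than the number of smaller values, and
  ranks depend on comparisons only.\<close>

lemma permutes_eqI_order:
  assumes "\<sigma> permutes {1..n}" "\<tau> permutes {1..n}"
    and "\<And>m m'. m \<in> {1..n} \<Longrightarrow> m' \<in> {1..n} \<Longrightarrow> \<sigma> m < \<sigma> m' \<longleftrightarrow> \<tau> m < \<tau> (m'::nat)"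
  shows "\<sigma> = \<tau>"
proof -
  have rank: "\<sigma> m = Suc (card {m' \<in> {1..n}. \<sigma> m' < \<sigma> m})" if s: "\<sigma> permutes {1..n}" "m \<in> {1..n}" for \<sigma> m
  proof -
    have "\<sigma> ` {m' \<in> {1..n}. \<sigma> m' < \<sigma> m} = {1..<\<sigma> m}"
    proof safe
      fix y assume y: "y \<in> {1..<\<sigma> m}"
      have "\<sigma> m \<in> {1..n}" using permutes_in_image[OF s(1)] s(2) by auto
      then have "y \<in> \<sigma> ` {1..n}" using y permutes_image[OF s(1)] by auto
      then show "y \<in> \<sigma> ` {m' \<in> {1..n}. \<sigma> m' < \<sigma> m}" using y by auto
    next
      fix m' assume "m' \<in> {1..n}" "\<sigma> m' < \<sigma> m"
      then show "\<sigma> m' \<in> {1..<\<sigma> m}" using permutes_in_image[OF s(1), of m'] by auto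
    qed
    moreover have "card (\<sigma> ` {m' \<in> {1..n}. \<sigma> m' < \<sigma> m}) = card {m' \<in> {1..n}. \<sigma> m' < \<sigma> m}"
      by (intro card_image permutes_inj_on[OF s(1)])
    moreover have "\<sigma> m \<ge> 1" using permutes_in_image[OF s(1), of m] s(2) by auto
    ultimately show ?thesis by simp
  qed
  have "\<sigma> m = \<tau> m" if "m \<in> {1..n}" for m
  proof -
    have "{m' \<in> {1..n}. \<sigma> m' < \<sigma> m} = {m' \<in> {1..n}. \<tau> m' < \<tau> m}" using assms(3) that by blast
    then show ?thesis using rank[OF assms(1) that] rank[OF assms(2) that] by simp
  qed
  moreover have "\<sigma> m = \<tau> m" if "m \<notin> {1..n}" for m
    using permutes_not_in[OF assms(1) that] permutes_not_in[OF assms(2) that] by simp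
  ultimately show ?thesis by (intro ext) blast
qed

lemma stable_less_transp: "stable_less v a b \<Longrightarrow> stable_less v b c \<Longrightarrow> stable_less v a c"
  by (auto simp: stable_less_def)

lemma exists_stable_sort:
  "\<exists>\<sigma>. \<sigma> permutes {1..n} \<and> (\<forall>m\<in>{1..n}. \<forall>m'\<in>{1..n}. \<sigma> m < \<sigma> m' \<longleftrightarrow> stable_less v m m')"
proof -
  \<comment> \<open>The witness is the rank in the order \<open>stable_less\<close>, counted from 1
    and continued by the identity as \<open>permutes\<close> requires.\<close>
  define \<sigma> where "\<sigma> m = (if m \<in> {1..n} then Suc (card {j \<in> {1..n}. stable_less v j m}) else m)" for m
  have mono: "\<sigma> m < \<sigma> m'" if "m \<in> {1..n}" "m' \<in> {1..n}" "stable_less v m m'" for m m'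
  proof -
    have "m \<notin> {j \<in> {1..n}. stable_less v j m}" by (simp add: stable_less_def)
    moreover have "m \<in> {j \<in> {1..n}. stable_less v j m'}" using that by simp
    moreover have "{j \<in> {1..n}. stable_less v j m} \<subseteq> {j \<in> {1..n}. stable_less v j m'}"
      using stable_less_transp[of v _ m m'] that(3) by blast
    ultimately have "{j \<in> {1..n}. stable_less v j m} \<subset> {j \<in> {1..n}. stable_less v j m'}" by blast
    then have "card {j \<in> {1..n}. stable_less v j m} < card {j \<in> {1..n}. stable_less v j m'}"
      by (intro psubset_card_mono) auto
    then show ?thesis using that by (simp add: \<sigma>_def)
  qed
  have tot: "stable_less v m m' \<or> m = m' \<or> stable_less v m' m" for m m'
    by (auto simp: stable_less_def)
  have inj: "inj_on \<sigma> {1..n}"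
    by (rule inj_onI) (metis mono tot less_irrefl)
  have "\<sigma> m \<in> {1..n}" if "m \<in> {1..n}" for m
  proof -
    have "m \<notin> {j \<in> {1..n}. stable_less v j m}" by (simp add: stable_less_def)
    then have "{j \<in> {1..n}. stable_less v j m} \<subset> {1..n}" using that by blast
    then have "card {j \<in> {1..n}. stable_less v j m} < card {1..n}" by (intro psubset_card_mono) auto
    then show ?thesis using that by (simp add: \<sigma>_def)
  qed
  then have "\<sigma> ` {1..n} = {1..n}"
    by (intro endo_inj_surj inj) auto
  then have "\<sigma> permutes {1..n}"
    using inj by (intro bij_imp_permutes) (auto simp: bij_betw_def \<sigma>_def)
  moreover have "\<forall>m\<in>{1..n}. \<forall>m'\<in>{1..n}. \<sigma> m < \<sigma> m' \<longleftrightarrow> stable_less v m m'"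
    by (metis mono tot less_irrefl less_asym)
  ultimately show ?thesis by blast
qed

text \<open>\<open>u\<close> holds the quotients in place and \<open>p\<close> the remainders in
  sorted order. This is why \<open>p\<close> is read through \<sigma> and has to respect the
  descents of \<open>inv \<sigma>\<close>.\<close>

definition merge_words :: "nat \<Rightarrow> nat \<Rightarrow> (nat \<Rightarrow> nat) \<times> (nat \<Rightarrow> nat) \<times> (nat \<Rightarrow> nat) \<Rightarrow> nat \<Rightarrow> nat" where
  "merge_words n l = (\<lambda>(\<sigma>, u, p). restrict (\<lambda>m. u m * l + p (\<sigma> m)) {1..n})"

text \<open>
  A weakly increasing word over \<open>{..<k * l}\<close> is a lexicographically increasing sequence of pairs
  (quotient, remainder) modulo \<open>l\<close>. The permutation is the stable sort of the remainders.
\<close>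

lemma bij_betw_merge_words:
  "bij_betw (merge_words n l)
     (SIGMA \<sigma>:{\<sigma>. \<sigma> permutes {1..n}}. ascending n k (Des n \<sigma>) \<times> ascending n l (Des n (inv \<sigma>)))
     (ascending n (k * l) {})"
  unfolding bij_betw_def
proof
  let ?D = "SIGMA \<sigma>:{\<sigma>. \<sigma> permutes {1..n}}. ascending n k (Des n \<sigma>) \<times> ascending n l (Des n (inv \<sigma>))"
  have dm: "merge_words n l (\<sigma>, u, p) m div l = u m" "merge_words n l (\<sigma>, u, p) m mod l = p (\<sigma> m)"
    if "\<sigma> permutes {1..n}" "p \<in> ascending n l (Des n (inv \<sigma>))" "m \<in> {1..n}" for \<sigma> u p m
  proof -
    have "p (\<sigma> m) < l"
      using ascendingD(1)[OF that(2), of "\<sigma> m"] permutes_in_image[OF that(1), of m] that(3) by auto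
    then show "merge_words n l (\<sigma>, u, p) m div l = u m" "merge_words n l (\<sigma>, u, p) m mod l = p (\<sigma> m)"
      using that(3) by (auto simp: merge_words_def)
  qed
  show "inj_on (merge_words n l) ?D"
  proof (rule inj_onI)
    fix X X' assume X: "X \<in> ?D" "X' \<in> ?D" "merge_words n l X = merge_words n l X'"
    obtain \<sigma> u p \<sigma>' u' p' where XX: "X = (\<sigma>, u, p)" "X' = (\<sigma>', u', p')"
      by (cases X, cases X') auto
    have s: "\<sigma> permutes {1..n}" "\<sigma>' permutes {1..n}"
      and u: "u \<in> ascending n k (Des n \<sigma>)" "u' \<in> ascending n k (Des n \<sigma>')"
      and p: "p \<in> ascending n l (Des n (inv \<sigma>))" "p' \<in> ascending n l (Des n (inv \<sigma>'))"
      and eq: "merge_words n l (\<sigma>, u, p) = merge_words n l (\<sigma>', u', p')"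
      using X unfolding XX by auto
    have "u m = u' m" for m
      using dm(1)[OF s(1) p(1), of m u] dm(1)[OF s(2) p(2), of m u'] eq
        ascendingD(4)[OF u(1), of m] ascendingD(4)[OF u(2), of m] by (cases "m \<in> {1..n}") auto
    then have "u = u'" by blast
    have v: "p (\<sigma> m) = p' (\<sigma>' m)" if "m \<in> {1..n}" for m
      using dm(2)[OF s(1) p(1) that, of u] dm(2)[OF s(2) p(2) that, of u'] eq by simp
    have "\<sigma> = \<sigma>'"
    proof (rule permutes_eqI_order[OF s])
      fix m m' assume m: "m \<in> {1..n}" "m' \<in> {1..n}"
      show "\<sigma> m < \<sigma> m' \<longleftrightarrow> \<sigma>' m < \<sigma>' m'"
        using permutation_less_iff_stable_less[OF s(1) p(1) m]
          permutation_less_iff_stable_less[OF s(2) p(2) m] v m by (simp add: stable_less_def)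
    qed
    have "p j = p' j" for j
    proof (cases "j \<in> {1..n}")
      case True
      then have "inv \<sigma> j \<in> {1..n}" using permutes_in_image[OF permutes_inv[OF s(1)], of j] by simp
      from v[OF this] show ?thesis using permutes_inverses(1)[OF s(1)] \<open>\<sigma> = \<sigma>'\<close> by simp
    next
      case False
      then show ?thesis using ascendingD(4)[OF p(1)] ascendingD(4)[OF p(2)] by simp
    qed
    then have "p = p'" by blast
    then show "X = X'" using \<open>u = u'\<close> \<open>\<sigma> = \<sigma>'\<close> XX by blast
  qed
  show "merge_words n l ` ?D = ascending n (k * l) {}"
  proof (intro equalityI subsetI)
    fix w assume "w \<in> merge_words n l ` ?D"
    then obtain \<sigma> u p where s: "\<sigma> permutes {1..n}" and u: "u \<in> ascending n k (Des n \<sigma>)"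
      and p: "p \<in> ascending n l (Des n (inv \<sigma>))" and w: "w = merge_words n l (\<sigma>, u, p)" by auto
    have r: "\<sigma> m \<in> {1..n}" if "m \<in> {1..n}" for m using permutes_in_image[OF s, of m] that by auto
    have "w m < k * l" if m: "m \<in> {1..n}" for m
    proof -
      have "u m < k" "p (\<sigma> m) < l" using ascendingD(1)[OF u m] ascendingD(1)[OF p r[OF m]] by auto
      then have "Suc (u m) * l \<le> k * l" by (intro mult_right_mono) auto
      moreover have "u m * l + p (\<sigma> m) < Suc (u m) * l" using \<open>p (\<sigma> m) < l\<close> by simp
      ultimately have "u m * l + p (\<sigma> m) < k * l" by linarith
      then show ?thesis using m by (simp add: w merge_words_def)
    qed
    moreover have "w m \<le> w (m + 1)" if m: "m \<in> {1..<n}" for m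
    proof -
      have m': "m \<in> {1..n}" "m + 1 \<in> {1..n}" using m by auto
      consider "u m < u (m + 1)" | "u m = u (m + 1)"
        using ascendingD(2)[OF u m] by fastforce
      then have "u m * l + p (\<sigma> m) \<le> u (m + 1) * l + p (\<sigma> (m + 1))"
      proof cases
        case 1
        then have "Suc (u m) * l \<le> u (m + 1) * l" by (intro mult_right_mono) auto
        then show ?thesis using ascendingD(1)[OF p r[OF m'(1)]] by simp
      next
        case 2
        \<comment> \<open>Equal quotients exclude a descent of \<sigma>, so the sorted remainders
          are read in increasing order here.\<close>
        then have "m \<notin> Des n \<sigma>" using ascendingD(3)[OF u m] by auto
        then have "\<sigma> m \<le> \<sigma> (m + 1)" using m by (auto simp: Des_def)
        then show ?thesis using 2 ascending_mono[OF p, of "\<sigma> m" "\<sigma> (m + 1)"] r[OF m'(1)] r[OF m'(2)] by auto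
      qed
      then show ?thesis using m' by (simp add: w merge_words_def)
    qed
    ultimately show "w \<in> ascending n (k * l) {}"
      by (auto simp: ascending_def w merge_words_def)
  next
    fix w assume w: "w \<in> ascending n (k * l) {}"
    define v where "v m = w m mod l" for m
    define u where "u = restrict (\<lambda>m. w m div l) {1..n}"
    obtain \<sigma> where s: "\<sigma> permutes {1..n}"
      and ord: "\<And>m m'. m \<in> {1..n} \<Longrightarrow> m' \<in> {1..n} \<Longrightarrow> \<sigma> m < \<sigma> m' \<longleftrightarrow> stable_less v m m'"
      using exists_stable_sort[of n v] by blast
    define p where "p = restrict (\<lambda>j. v (inv \<sigma> j)) {1..n}"
    have si: "inv \<sigma> permutes {1..n}" by (rule permutes_inv[OF s])
    have r: "\<sigma> m \<in> {1..n}" if "m \<in> {1..n}" for m using permutes_in_image[OF s, of m] that by auto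
    have ri: "inv \<sigma> m \<in> {1..n}" if "m \<in> {1..n}" for m using permutes_in_image[OF si, of m] that by auto
    have wl: "w m < k * l" if "m \<in> {1..n}" for m using ascendingD(1)[OF w that] .
    have lpos: "l > 0" if "m \<in> {1..n}" for m using wl[OF that] by (cases l) auto
    have "u \<in> ascending n k (Des n \<sigma>)"
    proof -
      have "u m < k" if "m \<in> {1..n}" for m
        using wl[OF that] that by (simp add: u_def less_mult_imp_div_less)
      moreover have "u m \<le> u (m + 1)" "m \<in> Des n \<sigma> \<Longrightarrow> u m < u (m + 1)" if m: "m \<in> {1..<n}" for m
      proof -
        have m': "m \<in> {1..n}" "m + 1 \<in> {1..n}" using m by auto
        have le: "w m \<le> w (m + 1)" using ascendingD(2)[OF w m] .
        show 1: "u m \<le> u (m + 1)" using m' le by (simp add: u_def div_le_mono)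
        assume "m \<in> Des n \<sigma>"
        then have "\<sigma> (m + 1) < \<sigma> m" using m by (simp add: Des_def)
        \<comment> \<open>A descent of the stable sort between neighbours is a strict drop of the
          remainder; as w does not drop, the quotient has to rise.\<close>
        then have "v (m + 1) < v m" using ord[OF m'(2,1)] by (auto simp: stable_less_def)
        then have "w m div l \<noteq> w (m + 1) div l"
          using le unfolding v_def by (metis add_le_cancel_left div_mult_mod_eq leD)
        then show "u m < u (m + 1)" using 1 m' by (simp add: u_def)
      qed
      ultimately show ?thesis by (auto simp: ascending_def u_def)
    qed
    moreover have "p \<in> ascending n l (Des n (inv \<sigma>))"
    proof -
      have "p j < l" if "j \<in> {1..n}" for j
        using that lpos[OF that] by (simp add: p_def v_def)
      moreover have "p j \<le> p (j + 1)" "j \<in> Des n (inv \<sigma>) \<Longrightarrow> p j < p (j + 1)" if j: "j \<in> {1..<n}" for j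
      proof -
        have j': "j \<in> {1..n}" "j + 1 \<in> {1..n}" using j by auto
        \<comment> \<open>Consecutive entries in sorted order: their remainders can tie only if the
          positions increase, so a descent of \<open>inv \<sigma>\<close> forces strictness.\<close>
        have "\<sigma> (inv \<sigma> j) < \<sigma> (inv \<sigma> (j + 1))" by (simp add: permutes_inverses(1)[OF s])
        then have "stable_less v (inv \<sigma> j) (inv \<sigma> (j + 1))" using ord[OF ri[OF j'(1)] ri[OF j'(2)]] by simp
        then show "p j \<le> p (j + 1)" "j \<in> Des n (inv \<sigma>) \<Longrightarrow> p j < p (j + 1)"
          using j' by (auto simp: p_def stable_less_def Des_def)
      qed
      ultimately show ?thesis by (auto simp: ascending_def p_def)
    qed
    moreover have "w = merge_words n l (\<sigma>, u, p)"
    proof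
      fix m
      show "w m = merge_words n l (\<sigma>, u, p) m"
      proof (cases "m \<in> {1..n}")
        case True
        then show ?thesis using r[OF True] permutes_inverses(2)[OF s] by (simp add: merge_words_def u_def p_def v_def)
      next
        case False
        then show ?thesis using ascendingD(4)[OF w] by (auto simp: merge_words_def)
      qed
    qed
    ultimately show "w \<in> merge_words n l ` ?D" using s by blast
  qed
qed

text \<open>Both sides count the weakly increasing words over k * l letters, directly and through
  \<open>bij_betw_merge_words\<close>.\<close>

lemma Carlitz_identity:
  assumes "n \<ge> 1"
  shows "(k * l + n - 1) choose n =
    (\<Sum>\<sigma> | \<sigma> permutes {1..n}. ((k - descents n \<sigma> + n - 1) choose n) * ((l - descents n (inv \<sigma>) + n - 1) choose n))"
proof -
  have "(k * l + n - 1) choose n = card (ascending n (k * l) {})"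
    using card_ascending[OF assms, of "k * l" "{}"] by simp
  also have "\<dots> = card (SIGMA \<sigma>:{\<sigma>. \<sigma> permutes {1..n}}. ascending n k (Des n \<sigma>) \<times> ascending n l (Des n (inv \<sigma>)))"
    using bij_betw_same_card[OF bij_betw_merge_words] by simp
  also have "\<dots> = (\<Sum>\<sigma> | \<sigma> permutes {1..n}. card (ascending n k (Des n \<sigma>) \<times> ascending n l (Des n (inv \<sigma>))))"
    by (intro card_SigmaI) (auto simp: finite_permutations)
  finally show ?thesis using card_ascending_Des[OF assms] by (simp add: card_cartesian_product)
qed

text \<open>
  If \<open>F\<^sub>n\<close> is the distribution function of the sum of \<open>n\<close> independent uniform variables on
  \<open>[0,1]\<close>, then \<open>irwin_hall n m a\<close> is \<open>m!\<close> times the \<open>(n - m)\<close>-th derivative of \<open>F\<^sub>n\<close> at \<open>a\<close>.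
\<close>

definition irwin_hall :: "nat \<Rightarrow> nat \<Rightarrow> nat \<Rightarrow> real" where
  "irwin_hall n m a = (\<Sum>k\<le>a. (-1) ^ (a - k) * real (n choose (a - k)) * real k ^ m)"

text \<open>Applying \<open>alternating_choose\<close> in both variables to
  \<open>Carlitz_identity\<close> isolates the joint count. The left-hand side of the identity is
  the rising factorial of k * l divided by n!, and its expansion in powers separates k from
  l.\<close>

lemma sum_descents_less:
  assumes n: "n \<ge> 1"
  shows "(\<Sum>\<sigma> | \<sigma> permutes {1..n}. of_bool (descents n \<sigma> < a) * of_bool (descents n (inv \<sigma>) < b)) =
    (\<Sum>m\<le>n. real (stirling n m) / fact n * irwin_hall n m a * irwin_hall n m b)"
proof -
  define c where "c = (\<lambda>a k. (-1) ^ (a - k) * real (n choose (a - k)))"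
  define g where "g = (\<lambda>k d. real ((k - d + n - 1) choose n))"
  have poly: "real ((k * l + n - 1) choose n) = (\<Sum>m\<le>n. real (stirling n m) / fact n * real k ^ m * real l ^ m)" for k l
  proof -
    have "real ((k * l + n - 1) choose n) = pochhammer (real (k * l)) n / fact n"
    proof (cases "k * l = 0")
      case True
      then show ?thesis using n by (auto simp: pochhammer_0_left)
    next
      case False
      then have "real (k * l) + real n - 1 = real (k * l + n - 1)"
        using n by (subst of_nat_diff) auto
      then have "real (k * l + n - 1) - real n + 1 = real (k * l)" by linarith
      then show ?thesis
        unfolding binomial_gbinomial gbinomial_pochhammer' by simp
    qed
    also have "\<dots> = (\<Sum>m\<le>n. real (stirling n m) * real (k * l) ^ m) / fact n"
      by (simp add: stirling_pochhammer)
    finally show ?thesis by (simp add: sum_divide_distrib power_mult_distrib mult_ac)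
  qed
  have "(\<Sum>\<sigma> | \<sigma> permutes {1..n}. of_bool (descents n \<sigma> < a) * of_bool (descents n (inv \<sigma>) < b)) =
    (\<Sum>\<sigma> | \<sigma> permutes {1..n}. (\<Sum>k\<le>a. c a k * g k (descents n \<sigma>)) * (\<Sum>l\<le>b. c b l * g l (descents n (inv \<sigma>))))"
    by (simp only: c_def g_def alternating_choose[OF n])
  also have "\<dots> = (\<Sum>k\<le>a. \<Sum>l\<le>b. c a k * c b l * (\<Sum>\<sigma> | \<sigma> permutes {1..n}. g k (descents n \<sigma>) * g l (descents n (inv \<sigma>))))"
  proof -
    have "(\<Sum>\<sigma> | \<sigma> permutes {1..n}. (\<Sum>k\<le>a. c a k * g k (descents n \<sigma>)) * (\<Sum>l\<le>b. c b l * g l (descents n (inv \<sigma>))))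
      = (\<Sum>\<sigma> | \<sigma> permutes {1..n}. \<Sum>k\<le>a. \<Sum>l\<le>b. c a k * c b l * (g k (descents n \<sigma>) * g l (descents n (inv \<sigma>))))"
      by (intro sum.cong refl) (simp add: sum_product mult_ac)
    also have "\<dots> = (\<Sum>k\<le>a. \<Sum>\<sigma> | \<sigma> permutes {1..n}. \<Sum>l\<le>b. c a k * c b l * (g k (descents n \<sigma>) * g l (descents n (inv \<sigma>))))"
      by (rule sum.swap)
    also have "\<dots> = (\<Sum>k\<le>a. \<Sum>l\<le>b. \<Sum>\<sigma> | \<sigma> permutes {1..n}. c a k * c b l * (g k (descents n \<sigma>) * g l (descents n (inv \<sigma>))))"
      by (intro sum.cong refl sum.swap)
    finally show ?thesis by (simp only: sum_distrib_left)
  qed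
  also have "\<dots> = (\<Sum>k\<le>a. \<Sum>l\<le>b. c a k * c b l * real ((k * l + n - 1) choose n))"
    by (simp only: Carlitz_identity[OF n] g_def of_nat_sum of_nat_mult)
  also have "\<dots> = (\<Sum>k\<le>a. \<Sum>l\<le>b. \<Sum>m\<le>n. real (stirling n m) / fact n * (c a k * real k ^ m) * (c b l * real l ^ m))"
    unfolding poly sum_distrib_left by (intro sum.cong refl) (simp only: mult_ac times_divide_eq_right)
  also have "\<dots> = (\<Sum>m\<le>n. \<Sum>k\<le>a. \<Sum>l\<le>b. real (stirling n m) / fact n * (c a k * real k ^ m) * (c b l * real l ^ m))"
  proof -
    have "(\<Sum>k\<le>a. \<Sum>l\<le>b. \<Sum>m\<le>n. real (stirling n m) / fact n * (c a k * real k ^ m) * (c b l * real l ^ m)) =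
      (\<Sum>k\<le>a. \<Sum>m\<le>n. \<Sum>l\<le>b. real (stirling n m) / fact n * (c a k * real k ^ m) * (c b l * real l ^ m))"
      by (intro sum.cong refl sum.swap)
    also have "\<dots> = (\<Sum>m\<le>n. \<Sum>k\<le>a. \<Sum>l\<le>b. real (stirling n m) / fact n * (c a k * real k ^ m) * (c b l * real l ^ m))"
      by (rule sum.swap)
    finally show ?thesis .
  qed
  also have "\<dots> = (\<Sum>m\<le>n. real (stirling n m) / fact n * irwin_hall n m a * irwin_hall n m b)"
  proof (intro sum.cong refl)
    fix m
    show "(\<Sum>k\<le>a. \<Sum>l\<le>b. real (stirling n m) / fact n * (c a k * real k ^ m) * (c b l * real l ^ m)) =
      real (stirling n m) / fact n * irwin_hall n m a * irwin_hall n m b"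
    proof -
      have "(\<Sum>k\<le>a. \<Sum>l\<le>b. real (stirling n m) / fact n * (c a k * real k ^ m) * (c b l * real l ^ m)) =
        real (stirling n m) / fact n * (\<Sum>k\<le>a. \<Sum>l\<le>b. (c a k * real k ^ m) * (c b l * real l ^ m))"
        by (simp only: sum_distrib_left mult.assoc)
      also have "\<dots> = real (stirling n m) / fact n * (irwin_hall n m a * irwin_hall n m b)"
        by (simp only: irwin_hall_def sum_product c_def)
      finally show ?thesis by (simp only: mult.assoc)
    qed
  qed
  finally show ?thesis .
qed

subsection \<open>Alternating power sums\<close>

text \<open>This is the n-th backward difference of z^m. It vanishes for m < n, by the induction
  hypothesis for the preceding order, and is constant for m = n, because its derivative in z is a
  multiple of the case m = n - 1.\<close>

lemma alternating_power_sum_const: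
  assumes "m \<le> n"
  shows "(\<Sum>i\<le>n. (-1) ^ i * real (n choose i) * (z - real i) ^ m) = (\<Sum>i\<le>n. (-1) ^ i * real (n choose i) * (w - real i) ^ m)"
  using assms
proof (induction n arbitrary: m z w)
  case 0
  then show ?case by simp
next
  case (Suc n)
  define D where "D n m z = (\<Sum>i\<le>n. (-1) ^ i * real (n choose i) * (z - real i) ^ m)" for n m z
  have step: "D (Suc n) m z = D n m z - D n m (z - 1)" for m z
  proof -
    have "D n m z = (\<Sum>i\<le>Suc n. (-1) ^ i * real (n choose i) * (z - real i) ^ m)"
      by (simp add: D_def)
    also have "\<dots> = z ^ m + (\<Sum>i\<le>n. (-1) ^ Suc i * real (n choose Suc i) * (z - real (Suc i)) ^ m)"
      by (subst sum.atMost_Suc_shift) simp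
    finally have 1: "D n m z = z ^ m + (\<Sum>i\<le>n. (-1) ^ Suc i * real (n choose Suc i) * (z - real (Suc i)) ^ m)" .
    have "D (Suc n) m z = z ^ m + (\<Sum>i\<le>n. (-1) ^ Suc i * real (Suc n choose Suc i) * (z - real (Suc i)) ^ m)"
      unfolding D_def by (subst sum.atMost_Suc_shift) simp
    also have "\<dots> = D n m z - D n m (z - 1)"
      unfolding 1 unfolding D_def by (simp add: sum.distrib[symmetric] sum_subtractf[symmetric] algebra_simps)
    finally show ?thesis .
  qed
  have zero: "D (Suc n) m z = 0" if "m \<le> n" for m z
    using Suc.IH[OF that, of z "z - 1"] step by (simp add: D_def)
  show ?case
  proof (cases "m \<le> n")
    case True
    then show ?thesis using zero by (simp add: D_def)
  next
    case False
    then have m: "m = Suc n" using Suc.prems by simp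
    have "((\<lambda>z. D (Suc n) m z) has_real_derivative 0) (at z)" for z
    proof -
      have "((\<lambda>z. D (Suc n) m z) has_real_derivative
          (\<Sum>i\<le>Suc n. (-1) ^ i * real (Suc n choose i) * (real m * (z - real i) ^ (m - 1)))) (at z)"
        unfolding D_def by (auto intro!: derivative_eq_intros sum.cong simp: mult_ac simp del: sum.atMost_Suc binomial_Suc_Suc)
      also have "(\<Sum>i\<le>Suc n. (-1) ^ i * real (Suc n choose i) * (real m * (z - real i) ^ (m - 1))) = real m * D (Suc n) n z"
        by (simp add: D_def m sum_distrib_left mult_ac del: sum.atMost_Suc)
      finally show ?thesis using zero[of n z] by simp
    qed
    then have "D (Suc n) m z = D (Suc n) m w" by (intro DERIV_isconst_all) auto
    then show ?thesis by (simp add: D_def)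
  qed
qed

lemma irwin_hall_altdef: "irwin_hall n m a = (\<Sum>i\<le>a. (-1) ^ i * real (n choose i) * (real a - real i) ^ m)"
  unfolding irwin_hall_def by (rule sum.reindex_bij_witness[of _ "\<lambda>i. a - i" "\<lambda>k. a - k"]) (auto simp: of_nat_diff)

text \<open>The symmetry of the sum of uniform variables about n / 2, in differentiated form. The
  complete alternating sum has the same value at b and at n; its terms beyond b, reversed by i -> n
  - i, form the right-hand side with sign (-1)^n (-1)^m.\<close>

lemma irwin_hall_complement:
  assumes "b \<le> n" "m \<le> n" "m \<ge> 1"
  shows "irwin_hall n m n - irwin_hall n m b = (-1) ^ (n - m) * irwin_hall n m (n - b)"
proof -
  define D where "D z = (\<Sum>i\<le>n. (-1) ^ i * real (n choose i) * (z - real i) ^ m)" for z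
  have "D (real b) = irwin_hall n m b + (\<Sum>i\<in>{b<..n}. (-1) ^ i * real (n choose i) * (real b - real i) ^ m)"
    unfolding D_def irwin_hall_altdef using assms(1)
    by (subst sum.union_disjoint[symmetric]) (auto intro!: sum.cong)
  also have "(\<Sum>i\<in>{b<..n}. (-1) ^ i * real (n choose i) * (real b - real i) ^ m) =
    (\<Sum>j<n - b. (-1) ^ (n - m) * ((-1) ^ j * real (n choose j) * (real (n - b) - real j) ^ m))"
  proof (rule sum.reindex_bij_witness[of _ "\<lambda>j. n - j" "\<lambda>i. n - i"])
    fix i assume i: "i \<in> {b<..n}"
    have "(-1::real) ^ m * (-1) ^ (n - m) = (-1) ^ n" using assms(2) by (simp flip: power_add)
    moreover have "(-1::real) ^ n * (-1) ^ (n - i) = (-1) ^ i"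
    proof -
      have "(-1::real) ^ n * (-1) ^ (n - i) = (-1) ^ (2 * (n - i) + i)"
        using i by (simp add: mult_2 flip: power_add)
      then show ?thesis by (simp add: power_add)
    qed
    moreover have "real (n - b) - real (n - i) = - (real b - real i)" using i assms(1) by (simp add: of_nat_diff)
    moreover have "n choose (n - i) = n choose i" using i by (simp add: binomial_symmetric[symmetric])
    moreover have "(- (real b - real i)) ^ m = (-1) ^ m * (real b - real i) ^ m" by (rule power_minus)
    ultimately show "(-1) ^ (n - m) * ((-1) ^ (n - i) * real (n choose (n - i)) * (real (n - b) - real (n - i)) ^ m) =
      (-1) ^ i * real (n choose i) * (real b - real i) ^ m"
      by (metis (no_types, lifting) mult.assoc mult.left_commute)
  qed auto
  \<comment> \<open>The added term j = n - b contains 0 ^ m, which is 0 because m \<ge> 1.\<close>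
  also have "\<dots> = (\<Sum>j\<le>n - b. (-1) ^ (n - m) * ((-1) ^ j * real (n choose j) * (real (n - b) - real j) ^ m))"
    using assms(3) by (intro sum.mono_neutral_left) (auto simp: not_less)
  also have "\<dots> = (-1) ^ (n - m) * irwin_hall n m (n - b)"
    by (simp add: irwin_hall_altdef sum_distrib_left)
  also have "D (real b) = D (real n)"
    unfolding D_def by (rule alternating_power_sum_const[OF assms(2)])
  also have "D (real n) = irwin_hall n m n" by (simp add: D_def irwin_hall_altdef)
  finally show ?thesis by simp
qed

subsection \<open>Contour integrals\<close>

text \<open>The majorant for the integrals over vertical lines. The exact value is kept because
  later c shrinks with j.\<close>

lemma integrable_inverse_quadratic:
  assumes "c > 0"
  shows "integrable lborel (\<lambda>u::real. 1 / (1 + c * u\<^sup>2))"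
    and "(\<integral>u. 1 / (1 + c * u\<^sup>2) \<partial>lborel) = pi / sqrt c"
proof -
  have e: "einterval (-\<infinity>) \<infinity> = (UNIV :: real set)" by (auto simp: einterval_def)
  have i: "integrable lborel (\<lambda>x::real. inverse (1 + x\<^sup>2))"
    using integrable_inverse_1_plus_square by (simp add: e set_integrable_def)
  have v: "(\<integral>x. inverse (1 + x\<^sup>2) \<partial>lborel) = pi"
    using LBINT_inverse_1_plus_square by (simp add: e interval_lebesgue_integral_def set_lebesgue_integral_def)
  have eq: "(\<lambda>u::real. 1 / (1 + c * u\<^sup>2)) = (\<lambda>u. inverse (1 + (0 + sqrt c * u)\<^sup>2))"
    using assms by (auto simp: power_mult_distrib inverse_eq_divide)
  show "integrable lborel (\<lambda>u::real. 1 / (1 + c * u\<^sup>2))"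
    unfolding eq using lborel_integrable_real_affine[OF i, of "sqrt c" 0] assms by simp
  have "(\<integral>x. inverse (1 + x\<^sup>2) \<partial>lborel) = \<bar>sqrt c\<bar> *\<^sub>R (\<integral>u. inverse (1 + (0 + sqrt c * u)\<^sup>2) \<partial>lborel)"
    using assms by (intro lborel_integral_real_affine) auto
  then show "(\<integral>u. 1 / (1 + c * u\<^sup>2) \<partial>lborel) = pi / sqrt c"
    unfolding eq v using assms by (simp add: field_simps)
qed

lemma contour_integral_rectpath:
  assumes "continuous_on (path_image (rectpath a1 a3)) f"
    and "Re a1 \<le> Re a3" "Im a1 \<le> Im a3"
  defines "a2 \<equiv> Complex (Re a3) (Im a1)" and "a4 \<equiv> Complex (Re a1) (Im a3)"
  shows "contour_integral (rectpath a1 a3) f = contour_integral (linepath a1 a2) f +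
    contour_integral (linepath a2 a3) f + contour_integral (linepath a3 a4) f + contour_integral (linepath a4 a1) f"
    and "\<And>a b. (a, b) \<in> {(a1, a2), (a2, a3), (a3, a4), (a4, a1)} \<Longrightarrow> f contour_integrable_on linepath a b"
proof -
  have r: "rectpath a1 a3 = linepath a1 a2 +++ linepath a2 a3 +++ linepath a3 a4 +++ linepath a4 a1"
    by (simp add: rectpath_def Let_def a2_def a4_def)
  have im: "path_image (rectpath a1 a3) = closed_segment a1 a2 \<union> closed_segment a2 a3 \<union> closed_segment a3 a4 \<union> closed_segment a4 a1"
    unfolding r by (simp add: path_image_join Un_assoc)
  show *: "\<And>a b. (a, b) \<in> {(a1, a2), (a2, a3), (a3, a4), (a4, a1)} \<Longrightarrow> f contour_integrable_on linepath a b"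
    by (rule contour_integrable_continuous_linepath, rule continuous_on_subset[OF assms(1)]) (auto simp: im)
  show "contour_integral (rectpath a1 a3) f = contour_integral (linepath a1 a2) f +
    contour_integral (linepath a2 a3) f + contour_integral (linepath a3 a4) f + contour_integral (linepath a4 a1) f"
    unfolding r by (simp add: * contour_integrable_join valid_path_join)
qed

lemma closed_segment_complex_rect:
  assumes "z \<in> closed_segment a b"
  shows "min (Re a) (Re b) \<le> Re z" "Re z \<le> max (Re a) (Re b)"
    "Re a = Re b \<Longrightarrow> Re z = Re a" "Im a = Im b \<Longrightarrow> Im z = Im a"
proof -
  obtain u where u: "0 \<le> u" "u \<le> 1" "z = (1 - u) *\<^sub>R a + u *\<^sub>R b" using assms by (auto simp: in_segment)
  then have "Re z \<in> closed_segment (Re a) (Re b)" by (auto simp: in_segment)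
  then show "min (Re a) (Re b) \<le> Re z" "Re z \<le> max (Re a) (Re b)"
    by (auto simp: closed_segment_eq_real_ivl split: if_splits)
  show "Re a = Re b \<Longrightarrow> Re z = Re a" "Im a = Im b \<Longrightarrow> Im z = Im a"
    by (simp_all add: u(3) left_diff_distrib)
qed

text \<open>Close the segment to the left around the pole at 0 if c > 0, where the residue is c^m /
  m!, and to the right, enclosing no pole, otherwise. On each of the three added sides the
  exponential is at most exp (c t) in modulus, the length is at most 2 R, and m \<ge> 1 makes the
  denominator at least R^2.\<close>

lemma vertical_line_integral_bound:
  fixes c t R :: real and m :: nat
  assumes t: "t > 0" and m: "m \<ge> 1" and R: "R \<ge> 1" "R \<ge> t"
  defines "f \<equiv> \<lambda>z::complex. exp (of_real c * z) / z ^ Suc m"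
  shows "norm (contour_integral (linepath (Complex t (- R)) (Complex t R)) f - 2 * pi * \<i> * (of_real (max 0 c) ^ m / fact m))
     \<le> 6 * exp (c * t) / R"
proof -
  have b: "norm (contour_integral (linepath p q) f) \<le> 2 * exp (c * t) / R"
    if i: "f contour_integrable_on linepath p q" and l: "norm (q - p) \<le> 2 * R"
      and z: "\<And>z. z \<in> closed_segment p q \<Longrightarrow> norm z \<ge> R \<and> c * Re z \<le> c * t" for p q
  proof -
    have "norm (contour_integral (linepath p q) f) \<le> exp (c * t) / R\<^sup>2 * norm (q - p)"
    proof (rule contour_integral_bound_linepath[OF i])
      fix w assume w: "w \<in> closed_segment p q"
      have "R\<^sup>2 \<le> R ^ Suc m" using R m by (intro power_increasing) auto
      also have "\<dots> \<le> norm w ^ Suc m" using z[OF w] R by (intro power_mono) auto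
      finally have "R\<^sup>2 \<le> norm w ^ Suc m" .
      then show "norm (f w) \<le> exp (c * t) / R\<^sup>2"
        unfolding f_def norm_divide norm_power using z[OF w] R by (intro frac_le) auto
    qed (use R in auto)
    also have "\<dots> \<le> exp (c * t) / R\<^sup>2 * (2 * R)" using l by (intro mult_left_mono) auto
    finally show ?thesis using R by (simp add: power2_eq_square mult.commute)
  qed
  have cont: "continuous_on (path_image (rectpath a1 a3)) f" if "0 \<notin> path_image (rectpath a1 a3)" for a1 a3
    unfolding f_def using that by (intro continuous_intros) auto
  have mz: "norm z \<ge> \<bar>Re z\<bar>" "norm z \<ge> \<bar>Im z\<bar>" for z by (auto simp: abs_Re_le_cmod abs_Im_le_cmod)
  show ?thesis
  proof (cases "c > 0")
    case True
    define a1 a2 a3 a4 where "a1 = Complex (- R) (- R)" and "a2 = Complex t (- R)" and "a3 = Complex t R" and "a4 = Complex (- R) R"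
    have box: "0 \<in> box a1 a3" using R t by (auto simp: a1_def a3_def in_box_complex_iff)
    have no: "0 \<notin> path_image (rectpath a1 a3)"
      using box R t by (subst path_image_rectpath_cbox_minus_box) (auto simp: a1_def a3_def)
    have "contour_integral (rectpath a1 a3) f = 2 * pi * \<i> * (\<Sum>p\<in>{0}. winding_number (rectpath a1 a3) p * residue f p)"
      by (rule Residue_theorem[of UNIV]) (use no in \<open>auto simp: f_def intro!: holomorphic_intros\<close>)
    moreover have "winding_number (rectpath a1 a3) 0 = 1" by (rule winding_number_rectpath[OF box])
    moreover have "residue f 0 = (deriv ^^ m) (\<lambda>z. exp (of_real c * z)) 0 / fact m"
      unfolding f_def by (rule residue_holomorphic_over_power'[of UNIV]) (auto intro!: holomorphic_intros)
    moreover have "(deriv ^^ m) (\<lambda>z. exp (complex_of_real c * z)) 0 = of_real c ^ m"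
    proof -
      have "(deriv ^^ m) (\<lambda>z. exp (complex_of_real c * z)) = (\<lambda>z. of_real c ^ m * exp (of_real c * z))"
      proof (induction m)
        case (Suc m)
        have "((\<lambda>z. of_real c ^ m * exp (of_real c * z)) has_field_derivative of_real c ^ Suc m * exp (of_real c * z)) (at z)" for z :: complex
          by (auto intro!: derivative_eq_intros)
        then show ?case by (simp add: Suc DERIV_imp_deriv fun_eq_iff)
      qed simp
      then show ?thesis by simp
    qed
    ultimately have I: "contour_integral (rectpath a1 a3) f = 2 * pi * \<i> * (of_real (max 0 c) ^ m / fact m)"
      using True by simp
    have aa: "Complex (Re a3) (Im a1) = a2" "Complex (Re a1) (Im a3) = a4" by (auto simp: a1_def a2_def a3_def a4_def)
    have le: "Re a1 \<le> Re a3" "Im a1 \<le> Im a3" using R t by (auto simp: a1_def a3_def)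
    note CI = contour_integral_rectpath[OF cont[OF no] le, unfolded aa]
    have cm: "c * Re z \<le> c * t" if "Re z \<le> t" for z using that True by (intro mult_left_mono) auto
    have "norm (contour_integral (linepath a1 a2) f) \<le> 2 * exp (c * t) / R"
    proof (rule b)
      show "norm (a2 - a1) \<le> 2 * R" using R t by (simp add: a1_def a2_def cmod_def)
      show "R \<le> cmod z \<and> c * Re z \<le> c * t" if "z \<in> closed_segment a1 a2" for z
        using closed_segment_complex_rect[OF that] mz(2)[of z] cm[of z] R t by (auto simp: a1_def a2_def)
    qed (use CI(2) in simp)
    moreover have "norm (contour_integral (linepath a3 a4) f) \<le> 2 * exp (c * t) / R"
    proof (rule b)
      show "norm (a4 - a3) \<le> 2 * R" using R t by (simp add: a3_def a4_def cmod_def)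
      show "R \<le> cmod z \<and> c * Re z \<le> c * t" if "z \<in> closed_segment a3 a4" for z
        using closed_segment_complex_rect[OF that] mz(2)[of z] cm[of z] R t by (auto simp: a3_def a4_def)
    qed (use CI(2) in simp)
    moreover have "norm (contour_integral (linepath a4 a1) f) \<le> 2 * exp (c * t) / R"
    proof (rule b)
      show "norm (a1 - a4) \<le> 2 * R" using R t by (simp add: a1_def a4_def cmod_def real_sqrt_mult)
      show "R \<le> cmod z \<and> c * Re z \<le> c * t" if "z \<in> closed_segment a4 a1" for z
        using closed_segment_complex_rect[OF that] mz(1)[of z] cm[of z] R t by (auto simp: a1_def a4_def)
    qed (use CI(2) in simp)
    moreover have "contour_integral (linepath a2 a3) f - 2 * pi * \<i> * (of_real (max 0 c) ^ m / fact m)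
      = - contour_integral (linepath a1 a2) f - contour_integral (linepath a3 a4) f - contour_integral (linepath a4 a1) f"
      using CI(1) I by (simp add: algebra_simps)
    moreover have "norm (- x - y - z) \<le> norm x + norm y + norm z" for x y z :: complex
      by (metis norm_minus_cancel norm_triangle_ineq4 norm_triangle_le_diff add_right_mono order_trans)
    ultimately have "norm (contour_integral (linepath a2 a3) f - 2 * pi * \<i> * (of_real (max 0 c) ^ m / fact m)) \<le> 2 * exp (c * t) / R + 2 * exp (c * t) / R + 2 * exp (c * t) / R"
      by (smt (verit))
    then show ?thesis by (simp add: a2_def a3_def)
  next
    case False
    define a1 a2 a3 a4 where "a1 = Complex t (- R)" and "a2 = Complex (R + t) (- R)" and "a3 = Complex (R + t) R" and "a4 = Complex t R"
    have no: "0 \<notin> cbox a1 a3" using t by (auto simp: a1_def a3_def in_cbox_complex_iff)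
    have le: "Re a1 \<le> Re a3" "Im a1 \<le> Im a3" using R t by (auto simp: a1_def a3_def)
    have sub: "path_image (rectpath a1 a3) \<subseteq> cbox a1 a3" using le by (intro path_image_rectpath_subset_cbox) auto
    have "(f has_contour_integral 0) (rectpath a1 a3)"
      by (rule Cauchy_theorem_convex_simple[of _ "cbox a1 a3"]) (use no sub in \<open>auto simp: f_def intro!: holomorphic_intros\<close>)
    then have I: "contour_integral (rectpath a1 a3) f = 0" by (rule contour_integral_unique)
    have aa: "Complex (Re a3) (Im a1) = a2" "Complex (Re a1) (Im a3) = a4" by (auto simp: a1_def a2_def a3_def a4_def)
    have no': "0 \<notin> path_image (rectpath a1 a3)" using no sub by blast
    note CI = contour_integral_rectpath[OF cont[OF no'] le, unfolded aa]
    have cm: "c * Re z \<le> c * t" if "Re z \<ge> t" for z using that False by (intro mult_left_mono_neg) auto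
    have "norm (contour_integral (linepath a1 a2) f) \<le> 2 * exp (c * t) / R"
    proof (rule b)
      show "norm (a2 - a1) \<le> 2 * R" using R t by (simp add: a1_def a2_def cmod_def)
      show "R \<le> cmod z \<and> c * Re z \<le> c * t" if "z \<in> closed_segment a1 a2" for z
        using closed_segment_complex_rect[OF that] mz(2)[of z] cm[of z] R t by (auto simp: a1_def a2_def)
    qed (use CI(2) in simp)
    moreover have "norm (contour_integral (linepath a3 a4) f) \<le> 2 * exp (c * t) / R"
    proof (rule b)
      show "norm (a4 - a3) \<le> 2 * R" using R t by (simp add: a3_def a4_def cmod_def)
      show "R \<le> cmod z \<and> c * Re z \<le> c * t" if "z \<in> closed_segment a3 a4" for z
        using closed_segment_complex_rect[OF that] mz(2)[of z] cm[of z] R t by (auto simp: a3_def a4_def)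
    qed (use CI(2) in simp)
    moreover have "norm (contour_integral (linepath a2 a3) f) \<le> 2 * exp (c * t) / R"
    proof (rule b)
      show "norm (a3 - a2) \<le> 2 * R" using R t by (simp add: a3_def a2_def cmod_def real_sqrt_mult)
      show "R \<le> cmod z \<and> c * Re z \<le> c * t" if "z \<in> closed_segment a2 a3" for z
        using closed_segment_complex_rect[OF that] mz(1)[of z] cm[of z] R t by (auto simp: a2_def a3_def)
    qed (use CI(2) in simp)
    moreover have "contour_integral (linepath a1 a4) f
      = contour_integral (linepath a1 a2) f + contour_integral (linepath a2 a3) f + contour_integral (linepath a3 a4) f"
    proof -
      have "contour_integral (linepath a4 a1) f = - contour_integral (linepath a1 a4) f"
        using contour_integral_reversepath[of "linepath a1 a4" f] by simp
      then show ?thesis using CI(1) I by (simp add: algebra_simps)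
    qed
    moreover have "norm (x + y + z) \<le> norm x + norm y + norm z" for x y z :: complex
      by (metis norm_triangle_ineq norm_triangle_le add_right_mono)
    ultimately have "norm (contour_integral (linepath a1 a4) f) \<le> 2 * exp (c * t) / R + 2 * exp (c * t) / R + 2 * exp (c * t) / R"
      by (smt (verit))
    moreover have "max 0 c = 0" using False by simp
    ultimately show ?thesis using m by (simp add: a1_def a4_def power_0_left)
  qed
qed

lemma norm_vertical_le:
  assumes t: "t > 0" and m: "m \<ge> 1"
  shows "norm (exp (of_real c * Complex t u) / Complex t u ^ Suc m) \<le> exp (c * t) / t ^ Suc m * (1 / (1 + 1 / t\<^sup>2 * u\<^sup>2))"
proof -
  have "norm (Complex t u) \<ge> t" using complex_Re_le_cmod[of "Complex t u"] by simp
  moreover have "norm (Complex t u) ^ 2 = t\<^sup>2 + u\<^sup>2" by (simp add: cmod_def)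
  moreover have "norm (Complex t u) ^ Suc m = norm (Complex t u) ^ 2 * norm (Complex t u) ^ (m - 1)"
    using m by (subst power_add[symmetric]) simp
  ultimately have "(t\<^sup>2 + u\<^sup>2) * t ^ (m - 1) \<le> norm (Complex t u) ^ Suc m"
    using t by (simp add: mult_left_mono power_mono)
  moreover have "(t\<^sup>2 + u\<^sup>2) * t ^ (m - 1) = t ^ Suc m * (1 + 1 / t\<^sup>2 * u\<^sup>2)"
  proof -
    have "t ^ Suc m = t\<^sup>2 * t ^ (m - 1)" using m by (subst power_add[symmetric]) simp
    then show ?thesis using t by (simp add: field_simps)
  qed
  ultimately have *: "t ^ Suc m * (1 + 1 / t\<^sup>2 * u\<^sup>2) \<le> norm (Complex t u) ^ Suc m" by simp
  have "0 < t ^ Suc m * (1 + 1 / t\<^sup>2 * u\<^sup>2)" using t by (intro mult_pos_pos add_pos_nonneg) auto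
  from frac_le[OF _ order_refl this *, of "exp (c * t)"]
  have "exp (c * t) / norm (Complex t u) ^ Suc m \<le> exp (c * t) / (t ^ Suc m * (1 + 1 / t\<^sup>2 * u\<^sup>2))"
    by (simp only: exp_ge_zero)
  then show ?thesis by (simp add: norm_divide norm_power norm_mult)
qed

text \<open>For m \<ge> 1 the integrand is absolutely integrable, so its integral is the limit over
  [-k, k], which the rectangles evaluate. The value does not depend on t, which leaves the abscissa
  free for the saddle point.\<close>

lemma inverse_laplace_power:
  fixes c t :: real
  assumes t: "t > 0" and m: "m \<ge> 1"
  defines "g \<equiv> \<lambda>u. exp (of_real c * Complex t u) / Complex t u ^ Suc m"
  shows "integrable lborel g" and "(\<integral>u. g u \<partial>lborel) = 2 * pi * of_real (max 0 c) ^ m / fact m"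
proof -
  have nz: "complex_of_real t + \<i> * of_real u \<noteq> 0" for u using t by (auto simp: complex_eq_iff)
  have "continuous_on UNIV g"
    unfolding g_def Complex_eq by (intro continuous_intros) (use nz in auto)
  then have meas[measurable]: "g \<in> borel_measurable lborel"
    by (simp add: borel_measurable_continuous_onI)
  have dom: "integrable lborel (\<lambda>u. exp (c * t) / t ^ Suc m * (1 / (1 + 1 / t\<^sup>2 * u\<^sup>2)))"
    using integrable_inverse_quadratic(1)[of "1 / t\<^sup>2"] t by (intro integrable_mult_right) auto
  have bd: "norm (g u) \<le> exp (c * t) / t ^ Suc m * (1 / (1 + 1 / t\<^sup>2 * u\<^sup>2))" for u
    unfolding g_def by (rule norm_vertical_le[OF t m])
  show int: "integrable lborel g"
  proof (rule Bochner_Integration.integrable_bound[OF dom])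
    show "AE u in lborel. norm (g u) \<le> norm (exp (c * t) / t ^ Suc m * (1 / (1 + 1 / t\<^sup>2 * u\<^sup>2)))"
      using order_trans[OF bd abs_ge_self] by (intro AE_I2) (simp only: real_norm_def)
  qed (use meas in simp)
  let ?I = "\<lambda>k::nat. (\<integral>u. indicator {- real k..real k} u *\<^sub>R g u \<partial>lborel)"
  have lim1: "?I \<longlonglongrightarrow> (\<integral>u. g u \<partial>lborel)"
  proof (rule integral_dominated_convergence[OF _ _ dom])
    show "AE u in lborel. (\<lambda>k. indicator {- real k..real k} u *\<^sub>R g u) \<longlonglongrightarrow> g u"
    proof (rule AE_I2, rule tendsto_eventually)
      fix u :: real
      show "eventually (\<lambda>k. indicator {- real k..real k} u *\<^sub>R g u = g u) sequentially"
        using eventually_ge_at_top[of "nat \<lceil>\<bar>u\<bar>\<rceil>"]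
      proof eventually_elim
        case (elim k)
        then have "\<bar>u\<bar> \<le> real k" by linarith
        then show ?case by (auto simp: indicator_def)
      qed
    qed
    show "AE u in lborel. norm (indicator {- real k..real k} u *\<^sub>R g u) \<le> exp (c * t) / t ^ Suc m * (1 / (1 + 1 / t\<^sup>2 * u\<^sup>2))" for k
      using bd t by (auto simp: indicator_def intro!: AE_I2)
  qed auto
  have eq: "?I k = - \<i> * contour_integral (linepath (Complex t (- real k)) (Complex t (real k))) (\<lambda>z. exp (of_real c * z) / z ^ Suc m)"
    if "k > 0" for k
  proof -
    have "set_integrable lborel {- real k..real k} g"
      unfolding set_integrable_def by (intro integrable_mult_indicator int) auto
    then have "?I k = integral {- real k..real k} g"
      using set_borel_integral_eq_integral(2) unfolding set_lebesgue_integral_def by blast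
    then show ?thesis
      using that by (subst contour_integral_linepath_same_Re[where c = t and a = "- real k" and b = "real k"]) (auto simp: g_def)
  qed
  let ?L = "2 * pi * of_real (max 0 c) ^ m / fact m :: complex"
  have "(\<lambda>k. ?I k - ?L) \<longlonglongrightarrow> 0"
  proof (rule Lim_null_comparison)
    show "eventually (\<lambda>k. norm (?I k - ?L) \<le> 6 * exp (c * t) / real k) sequentially"
      using eventually_ge_at_top[of "max 1 (nat \<lceil>t\<rceil>)"]
    proof eventually_elim
      case (elim k)
      then have k: "k \<ge> 1" "real k \<ge> t" by linarith+
      have "?I k - ?L = - \<i> * (contour_integral (linepath (Complex t (- real k)) (Complex t (real k))) (\<lambda>z. exp (of_real c * z) / z ^ Suc m)
         - 2 * pi * \<i> * (of_real (max 0 c) ^ m / fact m))"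
        using k by (subst eq) (auto simp: algebra_simps)
      then have "norm (?I k - ?L) = norm (contour_integral (linepath (Complex t (- real k)) (Complex t (real k))) (\<lambda>z. exp (of_real c * z) / z ^ Suc m)
         - 2 * pi * \<i> * (of_real (max 0 c) ^ m / fact m))"
        by (simp add: norm_mult)
      also have "\<dots> \<le> 6 * exp (c * t) / real k"
        using k by (intro vertical_line_integral_bound t m) auto
      finally show ?case .
    qed
    show "(\<lambda>k. 6 * exp (c * t) / real k) \<longlonglongrightarrow> 0"
      by (intro tendsto_divide_0[OF tendsto_const] filterlim_at_top_imp_at_infinity filterlim_real_sequentially)
  qed
  then have "?I \<longlonglongrightarrow> ?L" by (simp add: LIM_zero_iff)
  with lim1 show "(\<integral>u. g u \<partial>lborel) = ?L" by (rule LIMSEQ_unique)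
qed

text \<open>Expanding the n-th power and integrating termwise gives the truncated powers of k - a;
  those with k \<ge> a, counted from a, make up the value at n - a.\<close>

lemma irwin_hall_contour:
  fixes F :: "real \<Rightarrow> complex"
  assumes t: "t > 0" and m: "m \<ge> 1" and a: "a \<le> n"
  defines "F \<equiv> \<lambda>u. (exp (Complex t u) - 1) ^ n * exp (- real a * Complex t u) / Complex t u ^ Suc m"
  shows "complex_of_real (irwin_hall n m (n - a)) = fact m / (2 * pi) * (\<integral>u. F u \<partial>lborel)"
proof -
  define g where "g k u = exp (of_real (real k - real a) * Complex t u) / Complex t u ^ Suc m" for k u
  define c where "c k = complex_of_real ((-1) ^ (n - k) * real (n choose k))" for k
  have F: "F = (\<lambda>u. \<Sum>k\<le>n. c k * g k u)"
  proof
    fix u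
    let ?z = "Complex t u"
    have "(exp ?z - 1) ^ n = (exp ?z + (-1)) ^ n" by simp
    also have "\<dots> = (\<Sum>k\<le>n. of_nat (n choose k) * exp ?z ^ k * (-1) ^ (n - k))"
      by (rule binomial_ring)
    finally have "F u = (\<Sum>k\<le>n. of_nat (n choose k) * exp ?z ^ k * (-1) ^ (n - k)) * exp (- real a * ?z) / ?z ^ Suc m"
      by (simp only: F_def)
    also have "\<dots> = (\<Sum>k\<le>n. c k * g k u)"
      unfolding sum_distrib_right sum_divide_distrib
    proof (intro sum.cong refl)
      fix k
      have "exp ?z ^ k * exp (- real a * ?z) = exp (of_real (real k - real a) * ?z)"
        by (simp add: exp_of_nat_mult[symmetric] exp_add[symmetric] left_diff_distrib)
      moreover have "of_nat (n choose k) * exp ?z ^ k * (-1) ^ (n - k) * exp (- real a * ?z) / ?z ^ Suc m =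
        (-1) ^ (n - k) * of_nat (n choose k) * ((exp ?z ^ k * exp (- real a * ?z)) / ?z ^ Suc m)"
        by (simp only: mult_ac times_divide_eq_right)
      ultimately show "of_nat (n choose k) * exp ?z ^ k * (-1) ^ (n - k) * exp (- real a * ?z) / ?z ^ Suc m = c k * g k u"
        by (simp add: c_def g_def)
    qed
    finally show "F u = (\<Sum>k\<le>n. c k * g k u)" .
  qed
  have i: "integrable lborel (\<lambda>u. c k * g k u)" for k
    unfolding g_def by (intro integrable_mult_right inverse_laplace_power(1) t m)
  have "(\<integral>u. F u \<partial>lborel) = (\<Sum>k\<le>n. c k * (\<integral>u. g k u \<partial>lborel))"
    unfolding F by (simp add: Bochner_Integration.integral_sum i)
  also have "\<dots> = (\<Sum>k\<le>n. c k * (2 * pi * of_real (max 0 (real k - real a)) ^ m / fact m))"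
    unfolding g_def by (intro sum.cong refl arg_cong2[of _ _ _ _ "(*)"] inverse_laplace_power(2) t m)
  also have "\<dots> = 2 * pi / fact m * (\<Sum>k\<le>n. c k * of_real (max 0 (real k - real a)) ^ m)"
    by (simp add: sum_distrib_left mult_ac)
  also have "(\<Sum>k\<le>n. c k * of_real (max 0 (real k - real a)) ^ m) =
     of_real (\<Sum>k\<le>n. (-1) ^ (n - k) * real (n choose k) * (max 0 (real k - real a)) ^ m)"
    by (simp add: c_def)
  also have "(\<Sum>k\<le>n. (-1) ^ (n - k) * real (n choose k) * (max 0 (real k - real a)) ^ m) =
     (\<Sum>k\<in>{a..n}. (-1) ^ (n - k) * real (n choose k) * (max 0 (real k - real a)) ^ m)"
    using m by (intro sum.mono_neutral_right) auto
  also have "\<dots> = irwin_hall n m (n - a)"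
    unfolding irwin_hall_def
  proof (rule sum.reindex_bij_witness[of _ "\<lambda>j. j + a" "\<lambda>k. k - a"])
    fix k assume k: "k \<in> {a..n}"
    then have "n choose (n - k) = n choose k" by (simp add: binomial_symmetric[symmetric])
    then show "(-1) ^ (n - a - (k - a)) * real (n choose (n - a - (k - a))) * real (k - a) ^ m =
      (-1) ^ (n - k) * real (n choose k) * (max 0 (real k - real a)) ^ m"
      using k by (simp add: of_nat_diff)
  qed (use a in auto)
  finally show "complex_of_real (irwin_hall n m (n - a)) = fact m / (2 * pi) * (\<integral>u. F u \<partial>lborel)"
    by simp
qed

subsection \<open>The logarithmic Laplace transform\<close>

text \<open>The value at 0 fills the removable singularity, so that this is the derivative of
  \<open>log_laplace\<close> everywhere.\<close>

definition log_laplace' :: "real \<Rightarrow> real" where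
  "log_laplace' s = (if s = 0 then 1 / 2 else exp s / (exp s - 1) - 1 / s)"

text \<open>At 0 division by zero yields 0 instead of the true second derivative 1/12; the formula
  is used away from 0 only.\<close>

definition log_laplace'' :: "real \<Rightarrow> real" where
  "log_laplace'' s = 1 / s\<^sup>2 - exp s / (exp s - 1)\<^sup>2"

lemma exp_minus_one_over_pos: "s \<noteq> 0 \<Longrightarrow> (exp s - 1) / s > (0::real)"
  by (cases "s > 0") (auto simp: zero_less_divide_iff)

lemma DERIV_log_laplace: "(log_laplace has_real_derivative log_laplace' s) (at s)"
proof (cases "s = 0")
  case True
  have "((\<lambda>h::real. ln ((exp h - 1) / h) / h) \<longlongrightarrow> 1 / 2) (at 0)"
    by real_asymp
  then have "((\<lambda>h. (log_laplace (0 + h) - log_laplace 0) / h) \<longlongrightarrow> 1 / 2) (at 0)"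
    by (rule Lim_transform_eventually) (auto simp: eventually_at log_laplace_def intro!: exI[of _ 1])
  then show ?thesis using True by (simp add: log_laplace'_def DERIV_def)
next
  case False
  then have ne: "exp s - 1 \<noteq> 0" by simp
  have "((\<lambda>s. ln ((exp s - 1) / s)) has_real_derivative log_laplace' s) (at s)"
    using False ne exp_minus_one_over_pos[OF False]
    by (auto intro!: derivative_eq_intros simp: log_laplace'_def) (simp add: field_simps power2_eq_square)
  then show ?thesis
    by (rule has_field_derivative_transform_within_open[of _ _ _ "- {0}"]) (use False in \<open>auto simp: log_laplace_def\<close>)
qed

lemma deriv_log_laplace: "deriv log_laplace = log_laplace'"
  using DERIV_log_laplace DERIV_imp_deriv by blast

lemma DERIV_log_laplace':
  assumes "s \<noteq> 0"
  shows "(log_laplace' has_real_derivative log_laplace'' s) (at s)"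
proof -
  have ne: "exp s - 1 \<noteq> 0" using assms by simp
  have "((\<lambda>s. exp s / (exp s - 1) - 1 / s) has_real_derivative log_laplace'' s) (at s)"
    using assms ne
    by (auto intro!: derivative_eq_intros simp: log_laplace''_def) (simp add: field_simps power2_eq_square)
  then show ?thesis
    by (rule has_field_derivative_transform_within_open[of _ _ _ "- {0}"]) (use assms in \<open>auto simp: log_laplace'_def\<close>)
qed

text \<open>This is s / 2 < sinh (s / 2), obtained by differentiating: cosh > 1 by the
  arithmetic-geometric mean inequality. It gives both the strict convexity of
  \<open>log_laplace\<close> on positive reals and the constant below 1 in
  \<open>tilted_char_decay\<close>.\<close>

lemma sq_times_exp_less:
  fixes s :: real
  assumes "s > 0"
  shows "s\<^sup>2 * exp s < (exp s - 1)\<^sup>2"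
proof -
  let ?f = "\<lambda>s::real. exp (s / 2) - exp (- s / 2) - s"
  have "?f 0 < ?f s"
  proof (rule DERIV_pos_imp_increasing_open[OF assms])
    fix r :: real assume "0 < r" "r < s"
    have "exp (r / 2) * exp (- r / 2) = 1" by (simp flip: exp_add)
    moreover have "exp (r / 2) \<noteq> exp (- r / 2)" using \<open>0 < r\<close> by simp
    then have "(exp (r / 2) - exp (- r / 2))\<^sup>2 > 0" by simp
    moreover have "(exp (r / 2) + exp (- r / 2))\<^sup>2 = (exp (r / 2) - exp (- r / 2))\<^sup>2 + 4 * (exp (r / 2) * exp (- r / 2))"
      by (simp add: power2_eq_square algebra_simps)
    ultimately have "2\<^sup>2 < (exp (r / 2) + exp (- r / 2))\<^sup>2" by simp
    then have "exp (r / 2) + exp (- r / 2) > 2" by (rule power2_less_imp_less) (simp add: add_nonneg_nonneg)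
    then show "\<exists>y. (?f has_real_derivative y) (at r) \<and> 0 < y"
      by (intro exI[of _ "exp (r / 2) / 2 + exp (- r / 2) / 2 - 1"] conjI)
         (auto intro!: derivative_eq_intros)
  qed (auto intro!: continuous_intros)
  then have "s < exp (s / 2) - exp (- s / 2)" by simp
  then have "s * exp (s / 2) < (exp (s / 2) - exp (- s / 2)) * exp (s / 2)" by simp
  also have "\<dots> = exp s - 1" by (simp add: left_diff_distrib flip: exp_add)
  finally have "(s * exp (s / 2))\<^sup>2 < (exp s - 1)\<^sup>2" using assms by (intro power_strict_mono) auto
  moreover have "(exp (s / 2))\<^sup>2 = exp s" by (simp add: power2_eq_square flip: exp_add)
  ultimately show ?thesis by (simp add: power_mult_distrib)
qed

lemma log_laplace''_pos: "s > 0 \<Longrightarrow> log_laplace'' s > 0"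
proof -
  assume s: "s > 0"
  then have "(exp s - 1)\<^sup>2 > 0" by simp
  then have "s\<^sup>2 * exp s / (exp s - 1)\<^sup>2 < 1"
    using sq_times_exp_less[OF s] by (simp only: divide_less_eq_1_pos)
  then have "s\<^sup>2 * exp s / (exp s - 1)\<^sup>2 / s\<^sup>2 < 1 / s\<^sup>2"
    using s by (intro divide_strict_right_mono) auto
  then show ?thesis using s by (simp add: log_laplace''_def)
qed

lemma log_laplace'_strict_mono:
  assumes "0 < r" "r < s"
  shows "log_laplace' r < log_laplace' s"
proof (rule DERIV_pos_imp_increasing[OF assms(2)])
  fix q assume "r \<le> q" "q \<le> s"
  then have "q > 0" using assms by simp
  then show "\<exists>y. (log_laplace' has_real_derivative y) (at q) \<and> 0 < y"
    using DERIV_log_laplace'[of q] log_laplace''_pos[of q] by blast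
qed

lemma log_laplace'_tendsto: "(log_laplace' \<longlongrightarrow> 1 / 2) (at_right 0)" "(log_laplace' \<longlongrightarrow> 1) at_top"
proof -
  have "((\<lambda>s::real. exp s / (exp s - 1) - 1 / s) \<longlongrightarrow> 1 / 2) (at_right 0)" by real_asymp
  then show "(log_laplace' \<longlongrightarrow> 1 / 2) (at_right 0)"
    by (rule Lim_transform_eventually) (auto simp: eventually_at log_laplace'_def intro!: exI[of _ 1])
  have "((\<lambda>s::real. exp s / (exp s - 1) - 1 / s) \<longlongrightarrow> 1) at_top" by real_asymp
  then show "(log_laplace' \<longlongrightarrow> 1) at_top"
    by (rule Lim_transform_eventually) (use eventually_gt_at_top[of 0] in \<open>eventually_elim, auto simp: log_laplace'_def\<close>)
qed

lemma log_laplace'_gt_half: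
  assumes "s > 0"
  shows "log_laplace' s > 1 / 2"
proof -
  \<comment> \<open>The limit at 0 alone gives a weak inequality; the intermediate point s / 2 makes
    it strict.\<close>
  have "1 / 2 \<le> log_laplace' (s / 2)"
  proof (rule tendsto_upperbound[OF log_laplace'_tendsto(1)])
    show "eventually (\<lambda>r. log_laplace' r \<le> log_laplace' (s / 2)) (at_right 0)"
      unfolding eventually_at_right_field using assms log_laplace'_strict_mono[of _ "s / 2"]
      by (intro exI[of _ "s / 2"]) (auto intro: less_imp_le)
  qed simp
  also have "\<dots> < log_laplace' s" using assms by (intro log_laplace'_strict_mono) auto
  finally show ?thesis .
qed

text \<open>A uniform variable U on [0,1] has the law of 1 - U.\<close>

lemma log_laplace_minus: "log_laplace (- s) = log_laplace s - s"
proof (cases "s = 0")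
  case False
  have "(exp (- s) - 1) / (- s) = (exp s - 1) / s / exp s"
    using False by (simp add: exp_minus field_simps)
  then have "log_laplace (- s) = ln ((exp s - 1) / s / exp s)"
    using False by (simp add: log_laplace_def del: divide_divide_eq_left)
  also have "\<dots> = ln ((exp s - 1) / s) - ln (exp s)"
    by (subst ln_div) (use exp_minus_one_over_pos[OF False] in auto)
  finally show ?thesis using False by (simp add: log_laplace_def)
qed (simp add: log_laplace_def)

lemma log_laplace'_minus: "log_laplace' (- s) = 1 - log_laplace' s"
proof (cases "s = 0")
  case False
  then have "exp s - 1 \<noteq> 0" "1 - exp s \<noteq> 0" by auto
  then show ?thesis using False by (simp add: log_laplace'_def exp_minus field_simps)
qed (simp add: log_laplace'_def)

text \<open>The strict increase of \<open>log_laplace'\<close> from 1/2 to 1 on the positive reals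
  yields the saddle point, turns the definite description and the formal derivatives into usable
  formulas, and shows that the supremum is attained there.\<close>

lemma tilt_properties:
  assumes "x \<in> {1/2<..<1}"
  shows "tilt x > 0" "log_laplace' (tilt x) = x" "tilt_sd x = sqrt (log_laplace'' (tilt x))"
    "rate x = x * tilt x - log_laplace (tilt x)"
proof -
  obtain r where r: "r > 0" "log_laplace' r < x"
  proof -
    have "eventually (\<lambda>r. log_laplace' r < x) (at_right 0)"
      using order_tendstoD(2)[OF log_laplace'_tendsto(1), of x] assms by auto
    then obtain b where "b > 0" "\<And>r. 0 < r \<Longrightarrow> r < b \<Longrightarrow> log_laplace' r < x"
      unfolding eventually_at_right_field by auto
    then show ?thesis using that[of "b / 2"] by auto
  qed
  obtain s where s: "s > r" "log_laplace' s > x"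
  proof -
    have "eventually (\<lambda>s. log_laplace' s > x) at_top"
      using order_tendstoD(1)[OF log_laplace'_tendsto(2), of x] assms by auto
    then have "eventually (\<lambda>s. log_laplace' s > x \<and> s > r) at_top"
      using eventually_gt_at_top[of r] by eventually_elim auto
    then show ?thesis using that eventually_happens[of _ "at_top :: real filter"] by fastforce
  qed
  have "\<exists>t\<ge>r. t \<le> s \<and> log_laplace' t = x"
  proof (rule IVT')
    show "continuous_on {r..s} log_laplace'"
      using r by (intro DERIV_continuous_on[of _ _ log_laplace''])
        (auto intro!: has_field_derivative_at_within[OF DERIV_log_laplace'])
  qed (use r s in auto)
  then obtain t where "r \<le> t" and t: "log_laplace' t = x" by blast
  with r have t: "t > 0" "log_laplace' t = x" by auto
  have mono: "log_laplace' p < log_laplace' q" if "0 < p" "p < q" for p q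
    using log_laplace'_strict_mono that by blast
  have uniq: "q = t" if "log_laplace' q = x" for q
  proof (cases "q > 0")
    case True
    then show ?thesis using mono[of q t] mono[of t q] t that by (cases q t rule: linorder_cases) auto
  next
    case False
    \<comment> \<open>The description ranges over all reals; nonpositive q are excluded because x >
      1/2.\<close>
    have "log_laplace' q \<le> 1 / 2"
    proof (cases "q = 0")
      case False
      then have "- q > 0" using \<open>\<not> q > 0\<close> by simp
      from log_laplace'_gt_half[OF this] show ?thesis by (simp add: log_laplace'_minus)
    qed (simp add: log_laplace'_def)
    then show ?thesis using that assms by auto
  qed
  have tilt: "tilt x = t"
    unfolding tilt_def deriv_log_laplace by (rule the_equality) (fact t(2), rule uniq)
  show "tilt x > 0" "log_laplace' (tilt x) = x" using t tilt by auto
  show "tilt_sd x = sqrt (log_laplace'' (tilt x))"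
    unfolding tilt_sd_def deriv_log_laplace tilt using DERIV_imp_deriv[OF DERIV_log_laplace', of t] t by simp
  let ?f = "\<lambda>s. x * s - log_laplace s"
  have df: "(?f has_real_derivative x - log_laplace' s) (at s)" for s
    by (auto intro!: derivative_eq_intros DERIV_log_laplace)
  have pos: "?f s \<le> ?f t" if "s > 0" for s
  proof (cases s t rule: linorder_cases)
    case less
    show ?thesis
    proof (rule DERIV_nonneg_imp_nondecreasing[of s t ?f])
      fix q assume "s \<le> q" "q \<le> t"
      then have "log_laplace' q \<le> x" using mono[of q t] t that by (cases "q = t") auto
      then show "\<exists>y. (?f has_real_derivative y) (at q) \<and> 0 \<le> y" using df by force
    qed (use less in simp)
  next
    case greater
    show ?thesis
    proof (rule DERIV_nonpos_imp_nonincreasing[of t s ?f])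
      fix q assume "t \<le> q" "q \<le> s"
      then have "log_laplace' q \<ge> x" using mono[of t q] t by (cases "q = t") auto
      then show "\<exists>y. (?f has_real_derivative y) (at q) \<and> y \<le> 0" using df by force
    qed (use greater in simp)
  qed simp
  \<comment> \<open>Monotonicity of \<open>log_laplace'\<close> is available on positive reals only,
    so 0 is reached by continuity.\<close>
  have zero: "?f 0 \<le> ?f t"
  proof (rule tendsto_upperbound)
    show "(?f \<longlongrightarrow> ?f 0) (at_right 0)"
      using DERIV_isCont[OF df[of 0]] by (auto simp: isCont_def intro: filterlim_mono at_le)
    show "eventually (\<lambda>s. ?f s \<le> ?f t) (at_right 0)"
      using pos by (auto simp: eventually_at_right_field intro!: exI[of _ 1])
  qed simp
  have all: "?f s \<le> ?f t" for s
  proof (cases s "0 :: real" rule: linorder_cases)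
    case less
    \<comment> \<open>Reflection: for negative s the objective is no larger than its value at - s,
      since 1 - x \<le> x.\<close>
    have "?f s = (1 - x) * (- s) - log_laplace (- s)" using log_laplace_minus[of s] by (simp add: algebra_simps)
    also have "\<dots> \<le> x * (- s) - log_laplace (- s)" using assms less by (intro diff_right_mono mult_right_mono) auto
    also have "\<dots> \<le> ?f t" using less pos[of "- s"] by simp
    finally show ?thesis .
  qed (use pos zero in auto)
  show "rate x = x * tilt x - log_laplace (tilt x)"
    unfolding rate_def tilt by (rule cSup_eq_maximum) (use all in auto)
qed

subsection \<open>Saddle point asymptotics\<close>

text \<open>The characteristic function of the law on [0,1] with density proportional to exp (t
  r).\<close>

definition tilted_char :: "real \<Rightarrow> real \<Rightarrow> complex" where
  "tilted_char t u = (exp (Complex t u) - 1) / Complex t u / of_real ((exp t - 1) / t)"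

lemma norm_exp_minus_one_sq: "(cmod (exp (Complex t u) - 1))\<^sup>2 = (exp t - 1)\<^sup>2 + 2 * exp t * (1 - cos u)"
proof -
  have "(cmod (exp (Complex t u) - 1))\<^sup>2 = (exp t * cos u - 1)\<^sup>2 + (exp t * sin u)\<^sup>2"
    by (simp add: cmod_power2 Re_exp Im_exp)
  also have "\<dots> = (exp t)\<^sup>2 * ((sin u)\<^sup>2 + (cos u)\<^sup>2) - 2 * exp t * cos u + 1"
  proof -
    have "(a * p - 1)\<^sup>2 + (a * q)\<^sup>2 = a\<^sup>2 * (q\<^sup>2 + p\<^sup>2) - 2 * a * p + 1" for a p q :: real
      by (simp add: power2_eq_square algebra_simps)
    then show ?thesis .
  qed
  also have "\<dots> = (exp t - 1)\<^sup>2 + 2 * exp t * (1 - cos u)"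
    unfolding sin_cos_squared_add by (simp add: power2_eq_square algebra_simps)
  finally show ?thesis .
qed

lemma norm_tilted_char_sq:
  assumes "t > 0"
  shows "(cmod (tilted_char t u))\<^sup>2 = (1 + 2 * exp t * (1 - cos u) / (exp t - 1)\<^sup>2) / (1 + u\<^sup>2 / t\<^sup>2)"
proof -
  have E: "(exp t - 1)\<^sup>2 > 0" using assms by simp
  have "(cmod (tilted_char t u))\<^sup>2 = ((exp t - 1)\<^sup>2 + 2 * exp t * (1 - cos u)) / (t\<^sup>2 + u\<^sup>2) / ((exp t - 1)\<^sup>2 / t\<^sup>2)"
    unfolding tilted_char_def norm_divide power_divide norm_exp_minus_one_sq
    by (simp add: cmod_power2 norm_divide power_divide)
  also have "\<dots> = (((exp t - 1)\<^sup>2 + 2 * exp t * (1 - cos u)) / (exp t - 1)\<^sup>2) / ((t\<^sup>2 + u\<^sup>2) / t\<^sup>2)"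
    by simp
  also have "((exp t - 1)\<^sup>2 + 2 * exp t * (1 - cos u)) / (exp t - 1)\<^sup>2 = 1 + 2 * exp t * (1 - cos u) / (exp t - 1)\<^sup>2"
    using E by (simp add: add_divide_distrib)
  also have "(t\<^sup>2 + u\<^sup>2) / t\<^sup>2 = 1 + u\<^sup>2 / t\<^sup>2"
    using assms by (simp add: add_divide_distrib)
  finally show ?thesis .
qed

lemma one_minus_cos_le: "1 - cos u \<le> u\<^sup>2 / 2" for u :: real
proof -
  have "cos u = 1 - 2 * (sin (u / 2))\<^sup>2" using cos_double_sin[of "u / 2"] by simp
  moreover have "(sin (u / 2))\<^sup>2 \<le> (u / 2)\<^sup>2"
    using abs_sin_x_le_abs_x[of "u / 2"] by (simp only: abs_le_square_iff)
  ultimately show ?thesis by (simp add: power2_eq_square)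
qed

text \<open>One rational bound valid for all u replaces the usual split into a central and an outer
  region. The squared modulus is (1 + A) / (1 + p) with p = u^2 / t^2, where A \<le> \<kappa> p is
  effective for small u and A \<le> K for large u.\<close>

lemma tilted_char_decay:
  assumes t: "t > 0"
  obtains c where "c > 0" "\<And>u. (cmod (tilted_char t u))\<^sup>2 \<le> 1 / (1 + c * u\<^sup>2)"
proof -
  \<comment> \<open>\<kappa> < 1 is \<open>sq_times_exp_less\<close>, and c solves \<kappa> + c (1 +
    K) = 1, which makes (1 + A) (1 + c p) \<le> 1 + p.\<close>
  define \<kappa> K c where "\<kappa> = t\<^sup>2 * exp t / (exp t - 1)\<^sup>2" and "K = 4 * exp t / (exp t - 1)\<^sup>2"
    and "c = (1 - \<kappa>) / (1 + K)"
  have E: "(exp t - 1)\<^sup>2 > 0" using t by simp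
  have \<kappa>: "\<kappa> < 1" unfolding \<kappa>_def using sq_times_exp_less[OF t] E by (simp only: divide_less_eq_1_pos)
  have K: "K \<ge> 0" using E by (simp add: K_def)
  have c: "c > 0" using \<kappa> K by (simp add: c_def)
  have "(cmod (tilted_char t u))\<^sup>2 \<le> 1 / (1 + c / t\<^sup>2 * u\<^sup>2)" for u
  proof -
    define p A where "p = u\<^sup>2 / t\<^sup>2" and "A = 2 * exp t * (1 - cos u) / (exp t - 1)\<^sup>2"
    have p: "p \<ge> 0" by (simp add: p_def)
    have "2 * exp t * (1 - cos u) \<le> 2 * exp t * (u\<^sup>2 / 2)"
      using one_minus_cos_le by (intro mult_left_mono) auto
    then have "A \<le> 2 * exp t * (u\<^sup>2 / 2) / (exp t - 1)\<^sup>2"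
      unfolding A_def using E by (intro divide_right_mono) auto
    also have "\<dots> = \<kappa> * p" using t by (simp add: \<kappa>_def p_def)
    finally have A1: "A \<le> \<kappa> * p" .
    have "2 * exp t * (1 - cos u) \<le> 2 * exp t * 2"
      using cos_ge_minus_one[of u] by (intro mult_left_mono) auto
    then have A2: "A \<le> K" unfolding A_def K_def using E by (intro divide_right_mono) auto
    have "(1 + A) * (1 + c * p) = 1 + A + c * p * (1 + A)" by (simp add: algebra_simps)
    also have "\<dots> \<le> 1 + \<kappa> * p + c * p * (1 + K)"
      using A1 A2 c p by (intro add_mono mult_left_mono) auto
    also have "c * p * (1 + K) = (1 - \<kappa>) * p" using K by (simp add: c_def)
    also have "1 + \<kappa> * p + (1 - \<kappa>) * p = 1 + p" by (simp add: algebra_simps)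
    finally have "(1 + A) * (1 + c * p) \<le> 1 + p" .
    moreover have "1 + c * p > 0" "1 + p > 0" using c p by (auto intro!: add_pos_nonneg)
    ultimately have "(1 + A) / (1 + p) \<le> 1 / (1 + c * p)"
      by (simp add: divide_le_eq le_divide_eq)
    then show ?thesis using norm_tilted_char_sq[OF t, of u] by (simp add: A_def p_def)
  qed
  moreover have "c / t\<^sup>2 > 0" using c t by simp
  ultimately show ?thesis using that by blast
qed

text \<open>Bernoulli's inequality makes the coefficient of u^2 grow linearly in e; the factor 1/3
  absorbs the rounding, since e \<le> 3 (e div 2) for e \<ge> 2.\<close>

lemma power_decay:
  fixes r c u :: real
  assumes "r \<ge> 0" "r\<^sup>2 \<le> 1 / (1 + c * u\<^sup>2)" "c > 0" "e \<ge> (2::nat)"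
  shows "r ^ e \<le> 1 / (1 + real e / 3 * c * u\<^sup>2)"
proof -
  have y: "c * u\<^sup>2 \<ge> 0" using assms(3) by simp
  have "1 / (1 + c * u\<^sup>2) \<le> 1" using y by (simp add: divide_le_eq_1)
  then have "r\<^sup>2 \<le> 1\<^sup>2" using assms(2) by simp
  then have r1: "r \<le> 1" by (rule power2_le_imp_le) simp
  have "r ^ e \<le> r ^ (2 * (e div 2))" using assms(1) r1 by (intro power_decreasing) auto
  also have "\<dots> = (r\<^sup>2) ^ (e div 2)" by (simp add: power_mult)
  also have "\<dots> \<le> (1 / (1 + c * u\<^sup>2)) ^ (e div 2)" using assms(2) by (intro power_mono) auto
  also have "\<dots> = 1 / (1 + c * u\<^sup>2) ^ (e div 2)" by (simp add: power_one_over)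
  also have "\<dots> \<le> 1 / (1 + real e / 3 * c * u\<^sup>2)"
  proof (rule divide_left_mono)
    have "e \<le> 3 * (e div 2)" using assms(4) by presburger
    then have "real e \<le> 3 * real (e div 2)" using of_nat_mono by fastforce
    then have "real e / 3 \<le> real (e div 2)" by simp
    then have "real e / 3 * (c * u\<^sup>2) \<le> real (e div 2) * (c * u\<^sup>2)" using y by (rule mult_right_mono)
    then have "1 + real e / 3 * c * u\<^sup>2 \<le> 1 + real (e div 2) * (c * u\<^sup>2)" by (simp add: mult_ac)
    also have "\<dots> \<le> (1 + c * u\<^sup>2) ^ (e div 2)"
      using y by (intro Bernoulli_inequality) simp
    finally show "1 + real e / 3 * c * u\<^sup>2 \<le> (1 + c * u\<^sup>2) ^ (e div 2)" .
    show "0 < (1 + c * u\<^sup>2) ^ (e div 2) * (1 + real e / 3 * c * u\<^sup>2)"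
      using y assms(3) by (intro mult_pos_pos zero_less_power add_pos_nonneg) auto
  qed simp
  finally show ?thesis .
qed

text \<open>Since exp z - 1 is bounded on the line, each factor of the characteristic function can
  absorb one power of z.\<close>

lemma tilted_char_times_le:
  assumes "t > 0"
  shows "cmod (tilted_char t u) * cmod (Complex t u) \<le> (exp t + 1) / ((exp t - 1) / t)"
proof -
  have nz: "Complex t u \<noteq> 0" using assms by (auto simp: complex_eq_iff)
  have M: "(exp t - 1) / t > 0" using assms by simp
  have "tilted_char t u * Complex t u = (exp (Complex t u) - 1) / of_real ((exp t - 1) / t)"
    using nz by (simp add: tilted_char_def)
  then have "cmod (tilted_char t u) * cmod (Complex t u) = cmod (exp (Complex t u) - 1) / ((exp t - 1) / t)"
    using M by (metis norm_mult norm_divide norm_of_real abs_of_pos)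
  also have "\<dots> \<le> (exp t + 1) / ((exp t - 1) / t)"
  proof (rule divide_right_mono)
    show "cmod (exp (Complex t u) - 1) \<le> exp t + 1"
      using norm_triangle_ineq4[of "exp (Complex t u)" 1] by simp
  qed (use M in simp)
  finally show ?thesis .
qed

text \<open>
  The integrand of \<open>irwin_hall_contour\<close>, divided by \<open>exp (- a * t) * ((exp t - 1) / t) ^ n\<close> and
  written in the variable \<open>v = sqrt n * Im z\<close>; the number \<open>j\<close> is the order of the derivative.
\<close>

definition saddle_kernel :: "real \<Rightarrow> real \<Rightarrow> nat \<Rightarrow> nat \<Rightarrow> real \<Rightarrow> complex" where
  "saddle_kernel t a n j v = (let u = v / sqrt (real n) in
     tilted_char t u ^ n * exp (- \<i> * of_real (a * u)) * Complex t u ^ j / Complex t u)"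

lemma irwin_hall_saddle:
  assumes t: "t > 0" and m: "m \<ge> 1" and n: "n = m + j" and a: "a \<le> n"
  shows "complex_of_real (irwin_hall n m (n - a)) =
      of_real (fact m * (exp (- real a * t) * ((exp t - 1) / t) ^ n) / (2 * pi * sqrt (real n))) *
        (\<integral>v. saddle_kernel t (real a) n j v \<partial>lborel)"
proof -
  define F where "F = (\<lambda>u. (exp (Complex t u) - 1) ^ n * exp (- real a * Complex t u) / Complex t u ^ Suc m)"
  define C where "C = exp (- real a * t) * ((exp t - 1) / t) ^ n"
  have M: "(exp t - 1) / t > 0" using t by simp
  have C: "C > 0" unfolding C_def using M by simp
  have sn: "sqrt (real n) > 0" using n m by simp
  have eq: "F (v / sqrt (real n)) = of_real C * saddle_kernel t (real a) n j v" for v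
  proof -
    define u z where "u = v / sqrt (real n)" and "z = Complex t u"
    have nz: "z \<noteq> 0" using t by (auto simp: z_def complex_eq_iff)
    have 1: "exp (- real a * z) = of_real (exp (- real a * t)) * exp (- \<i> * of_real (real a * u))"
      unfolding z_def Complex_eq exp_of_real[symmetric] exp_add[symmetric] by (simp add: algebra_simps)
    have 2: "(exp z - 1) ^ n = of_real (((exp t - 1) / t) ^ n) * tilted_char t u ^ n * z ^ n"
    proof -
      have "of_real ((exp t - 1) / t) * tilted_char t u * z = exp z - 1"
        unfolding tilted_char_def z_def[symmetric] using nz M t by (simp del: of_real_divide)
      then show ?thesis by (metis power_mult_distrib of_real_power)
    qed
    \<comment> \<open>The n-th power of (exp z - 1) / z hides a factor z^n, which cancels the
      denominator up to z^j / z; this is how the order of the derivative enters the kernel.\<close>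
    have 3: "z ^ n / z ^ Suc m = z ^ j / z" using nz by (simp add: n power_add)
    have "(exp z - 1) ^ n * exp (- real a * z) / z ^ Suc m =
      of_real (((exp t - 1) / t) ^ n) * tilted_char t u ^ n * z ^ n *
        (of_real (exp (- real a * t)) * exp (- \<i> * of_real (real a * u))) / z ^ Suc m"
      by (simp only: 1 2)
    also have "\<dots> = of_real (((exp t - 1) / t) ^ n) * tilted_char t u ^ n *
        (of_real (exp (- real a * t)) * exp (- \<i> * of_real (real a * u))) * (z ^ n / z ^ Suc m)"
      by (simp only: mult_ac times_divide_eq_right times_divide_eq_left)
    finally have "(exp z - 1) ^ n * exp (- real a * z) / z ^ Suc m =
      of_real (((exp t - 1) / t) ^ n) * tilted_char t u ^ n *
        (of_real (exp (- real a * t)) * exp (- \<i> * of_real (real a * u))) * (z ^ j / z)"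
      by (simp only: 3)
    then show ?thesis
      unfolding F_def C_def saddle_kernel_def Let_def u_def[symmetric] z_def[symmetric] of_real_mult
      by (simp only: mult_ac times_divide_eq_right times_divide_eq_left)
  qed
  note F = irwin_hall_contour[OF t m a, folded F_def]
  have "(\<integral>u. F u \<partial>lborel) = \<bar>1 / sqrt (real n)\<bar> *\<^sub>R (\<integral>v. F (0 + 1 / sqrt (real n) * v) \<partial>lborel)"
    using sn by (intro lborel_integral_real_affine) auto
  also have "(\<lambda>v. F (0 + 1 / sqrt (real n) * v)) = (\<lambda>v. of_real C * saddle_kernel t (real a) n j v)"
    using eq by (auto simp: fun_eq_iff)
  finally have "(\<integral>u. F u \<partial>lborel) = of_real (C / sqrt (real n)) * (\<integral>v. saddle_kernel t (real a) n j v \<partial>lborel)"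
    using sn by (simp add: scaleR_conv_of_real)
  then show "complex_of_real (irwin_hall n m (n - a)) =
      of_real (fact m * (exp (- real a * t) * ((exp t - 1) / t) ^ n) / (2 * pi * sqrt (real n))) *
        (\<integral>v. saddle_kernel t (real a) n j v \<partial>lborel)"
    using F by (simp add: C_def)
qed

text \<open>Uniform in a and in all j < n. For j \<ge> 1, j - 1 factors of the characteristic
  function absorb the powers of z at cost C each; the others provide the decay, which weakens with j
  but not with n.\<close>

lemma saddle_kernel_bound:
  assumes t: "t > 0"
  obtains c C where "c > 0" "C \<ge> 1"
    "\<And>a n j v. n \<ge> 2 \<Longrightarrow> j < n \<Longrightarrow> cmod (saddle_kernel t a n j v) \<le> C ^ Suc j * (1 / (1 + c / real (Suc j) * v\<^sup>2))"
proof -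
  obtain c where c: "c > 0" "\<And>u. (cmod (tilted_char t u))\<^sup>2 \<le> 1 / (1 + c * u\<^sup>2)"
    using tilted_char_decay[OF t] by blast
  define B where "B = (exp t + 1) / ((exp t - 1) / t)"
  define C where "C = max 1 (max B (1 / t))"
  have C: "C \<ge> 1" "C \<ge> B" "C \<ge> 1 / t" by (auto simp: C_def)
  have "cmod (saddle_kernel t a n j v) \<le> C ^ Suc j * (1 / (1 + (c / 3) / real (Suc j) * v\<^sup>2))"
    if n: "n \<ge> 2" "j < n" for a n j v
  proof -
    define u where "u = v / sqrt (real n)"
    \<comment> \<open>The number of factors left after the absorption. It is at least 2, which is
      what integrability requires.\<close>
    define e where "e = (if j = 0 then n else n - j + 1)"
    define r z where "r = cmod (tilted_char t u)" and "z = cmod (Complex t u)"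
    have e: "e \<ge> 2" using n by (auto simp: e_def)
    have r: "r \<ge> 0" by (simp add: r_def)
    have z: "z \<ge> t" using complex_Re_le_cmod[of "Complex t u"] by (simp add: z_def)
    have rz: "r * z \<le> C" using tilted_char_times_le[OF t, of u] C by (simp add: r_def z_def B_def)
    have norm_eq: "cmod (saddle_kernel t a n j v) = r ^ n * z ^ j / z"
      by (simp add: saddle_kernel_def Let_def u_def[symmetric] r_def z_def norm_mult norm_divide norm_power)
    also have "\<dots> \<le> C ^ Suc j * r ^ e"
    proof (cases j)
      case 0
      have "1 / z \<le> 1 / t" using z t by (intro divide_left_mono) auto
      then have "1 / z \<le> C" using C by simp
      then have "r ^ n * (1 / z) \<le> r ^ n * C" using r by (intro mult_left_mono) auto
      then show ?thesis using 0 by (simp add: e_def mult.commute)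
    next
      case (Suc i)
      have "r ^ n = r ^ i * r ^ e" using n Suc by (subst power_add[symmetric]) (simp add: e_def)
      then have "r ^ n * z ^ j / z = (r * z) ^ i * r ^ e"
        using z t Suc by (simp add: power_mult_distrib)
      also have "\<dots> \<le> C ^ i * r ^ e"
        using rz r z t by (intro mult_right_mono power_mono mult_nonneg_nonneg) auto
      also have "\<dots> \<le> C ^ Suc j * r ^ e"
        using C r Suc by (intro mult_right_mono power_increasing) auto
      finally show ?thesis .
    qed
    also have "r ^ e \<le> 1 / (1 + real e / 3 * c * u\<^sup>2)"
      using power_decay[OF r _ c(1) e] c(2) by (simp add: r_def)
    also have "\<dots> \<le> 1 / (1 + (c / 3) / real (Suc j) * v\<^sup>2)"
    proof (rule divide_left_mono)
      \<comment> \<open>This bounds the coefficient e / n of v^2 from below by 1 / (j + 1), free of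
        n.\<close>
      have "n \<le> e * Suc j"
      proof (cases j)
        case (Suc i)
        have "n = (n - j) + j" using n by simp
        also have "\<dots> \<le> (n - j + 1) * Suc j" by (simp add: add_mult_distrib)
        finally show ?thesis using Suc by (simp add: e_def)
      qed (simp add: e_def)
      from of_nat_mono[OF this] have "real n \<le> real e * real (Suc j)" by (simp only: of_nat_mult)
      then have "1 / real (Suc j) \<le> real e / real n" using n by (simp add: field_simps)
      then have "1 / real (Suc j) * (c / 3 * v\<^sup>2) \<le> real e / real n * (c / 3 * v\<^sup>2)"
        using c by (intro mult_right_mono) auto
      moreover have "u\<^sup>2 = v\<^sup>2 / real n" by (simp add: u_def power_divide)
      ultimately show "1 + (c / 3) / real (Suc j) * v\<^sup>2 \<le> 1 + real e / 3 * c * u\<^sup>2" by (simp add: mult_ac)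
      show "0 < (1 + real e / 3 * c * u\<^sup>2) * (1 + (c / 3) / real (Suc j) * v\<^sup>2)"
        using c by (intro mult_pos_pos add_pos_nonneg) auto
    qed simp
    finally show ?thesis using C by (simp add: mult_left_mono)
  qed
  then show ?thesis using that[of "c / 3" C] c C by simp
qed

text \<open>\<open>g\<close> is the centred Laplace transform of the tilted law, with g 0 = 1 and, t
  being the saddle point for x, g' 0 = 0. Writing g' = g q with the logarithmic derivative q, where
  q 0 = 0 and q' 0 = \<open>log_laplace'' t\<close>, gives the quadratic term without choosing a
  branch of the complex logarithm.\<close>

lemma second_order_limit:
  fixes t :: real
  assumes t: "t > 0"
  defines "x \<equiv> complex_of_real (log_laplace' t)" and "M \<equiv> complex_of_real ((exp t - 1) / t)"
  defines "g \<equiv> \<lambda>w. exp (- x * w) * ((exp (of_real t + w) - 1) / (of_real t + w)) / M"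
  shows "((\<lambda>w. (g w - 1) / w\<^sup>2) \<longlongrightarrow> of_real (log_laplace'' t / 2)) (at 0)"
proof -
  define q where "q w = exp (of_real t + w) / (exp (of_real t + w) - 1) - 1 / (of_real t + w) - x" for w
  define s where "s = complex_of_real (log_laplace'' t)"
  have M0: "M \<noteq> 0" using t by (simp add: M_def)
  have E0: "exp (complex_of_real t) - 1 = of_real (exp t - 1)" by (simp add: exp_of_real)
  have nz: "of_real t + w \<noteq> 0" "exp (of_real t + w) - 1 \<noteq> 0" if "cmod w < t" for w
  proof -
    have "Re (of_real t + w) > 0" using abs_Re_le_cmod[of w] that by simp
    moreover have "Re z \<le> 0" if "exp z - 1 = 0" for z
    proof -
      have "cmod (exp z) = 1" using that by simp
      then show ?thesis by simp
    qed
    ultimately show "of_real t + w \<noteq> 0" "exp (of_real t + w) - 1 \<noteq> 0" by (force, force)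
  qed
  have dg: "(g has_field_derivative g w * q w) (at w)" if "cmod w < t" for w
  proof -
    have d1: "((\<lambda>w. exp (- x * w)) has_field_derivative - x * exp (- x * w)) (at w)"
      by (auto intro!: derivative_eq_intros)
    have d2: "((\<lambda>w. (exp (of_real t + w) - 1) / (of_real t + w)) has_field_derivative
        (exp (of_real t + w) * (of_real t + w) - (exp (of_real t + w) - 1) * 1) / ((of_real t + w) * (of_real t + w))) (at w)"
      using nz[OF that] by (auto intro!: derivative_eq_intros)
    have alg: "(- x * A * ((B - 1) / C) + (B * C - (B - 1) * 1) / (C * C) * A) / M = A * ((B - 1) / C) / M * (B / (B - 1) - 1 / C - x)"
      if "C \<noteq> 0" "B - 1 \<noteq> 0" for A B C :: complex
    proof -
      have "(B * C - (B - 1) * 1) / (C * C) = ((B - 1) / C) * (B / (B - 1) - 1 / C)"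
        using that by (simp add: field_simps)
      then have "- x * A * ((B - 1) / C) + (B * C - (B - 1) * 1) / (C * C) * A = A * ((B - 1) / C) * (B / (B - 1) - 1 / C - x)"
        by (simp only:) (simp only: right_diff_distrib mult_ac mult_minus_left mult_minus_right, simp)
      then show ?thesis by (simp only: times_divide_eq_left)
    qed
    show ?thesis
      using DERIV_cdivide[OF DERIV_mult[OF d1 d2], of M] unfolding alg[OF nz[OF that]] g_def q_def .
  qed
  have g0: "g 0 = 1" using M0 by (simp add: g_def M_def E0)
  have q0: "q 0 = 0" using t by (simp add: q_def x_def log_laplace'_def E0 exp_of_real)
  have dq: "(q has_field_derivative s) (at 0)"
  proof -
    have n: "of_real t \<noteq> (0 :: complex)" "exp (of_real t) - (1 :: complex) \<noteq> 0" using nz[of 0] t by auto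
    have "(q has_field_derivative
      (exp (of_real t) * (exp (of_real t) - 1) - exp (of_real t) * exp (of_real t)) / ((exp (of_real t) - 1) * (exp (of_real t) - 1)) + 1 / (of_real t)\<^sup>2) (at 0)"
      unfolding q_def using n by (auto intro!: derivative_eq_intros simp: power2_eq_square)
    also have "(exp (of_real t) * (exp (of_real t) - 1) - exp (of_real t) * exp (of_real t)) / ((exp (of_real t) - 1) * (exp (of_real t) - 1)) + 1 / (of_real t)\<^sup>2 = s"
      by (simp add: s_def log_laplace''_def exp_of_real power2_eq_square algebra_simps)
    finally show ?thesis .
  qed
  have "((\<lambda>w. g w * q w) has_field_derivative s) (at 0)"
    using DERIV_mult[OF dg[of 0] dq] t g0 q0 by simp
  then have lim: "((\<lambda>w. g w * q w / w) \<longlongrightarrow> s) (at 0)"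
    by (simp add: DERIV_def q0)
  show ?thesis
  proof (rule LIM_I)
    fix \<epsilon> :: real assume \<epsilon>: "\<epsilon> > 0"
    obtain \<delta> where \<delta>: "\<delta> > 0" "\<And>w. w \<noteq> 0 \<Longrightarrow> cmod w < \<delta> \<Longrightarrow> cmod (g w * q w / w - s) < \<epsilon> / 2"
      using LIM_D[OF lim, of "\<epsilon> / 2"] \<epsilon> by auto
    have bd: "cmod (g w * q w - s * w) \<le> \<epsilon> / 2 * cmod w" if "cmod w < \<delta>" for w
    proof (cases "w = 0")
      case False
      have "cmod (g w * q w - s * w) = cmod (g w * q w / w - s) * cmod w"
        using False by (simp add: norm_mult[symmetric] left_diff_distrib)
      then show ?thesis using mult_right_mono[OF less_imp_le[OF \<delta>(2)[OF False that]] norm_ge_zero[of w]] by (simp only:)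
    qed (simp add: q0)
    show "\<exists>d>0. \<forall>w. w \<noteq> 0 \<and> cmod (w - 0) < d \<longrightarrow> cmod ((g w - 1) / w\<^sup>2 - of_real (log_laplace'' t / 2)) < \<epsilon>"
    proof (intro exI[of _ "min \<delta> t"] conjI allI impI)
      show "min \<delta> t > 0" using \<delta> t by simp
      fix w assume w: "w \<noteq> 0 \<and> cmod (w - 0) < min \<delta> t"
      \<comment> \<open>The second order Taylor remainder. Its derivative is at most \<epsilon> |w|
        / 2 on the disc of radius |w|, and integrating gains another factor |w|.\<close>
      define H where "H w = g w - 1 - s * w\<^sup>2 / 2" for w
      have "cmod (H w - H 0) \<le> (\<epsilon> / 2 * cmod w) * cmod (w - 0)"
      proof (rule field_differentiable_bound[where S = "cball 0 (cmod w)" and f' = "\<lambda>w. g w * q w - s * w"])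
        fix z :: complex assume z: "z \<in> cball 0 (cmod w)"
        have zt: "cmod z < t" using z w by simp
        show "(H has_field_derivative g z * q z - s * z) (at z within cball 0 (cmod w))"
        proof -
          have "((\<lambda>w. s * w\<^sup>2 / 2) has_field_derivative s * z) (at z)" by (auto intro!: derivative_eq_intros)
          from DERIV_diff[OF DERIV_diff[OF dg[OF zt] DERIV_const[of 1]] this]
          have "(H has_field_derivative g z * q z - s * z) (at z)"
            unfolding H_def by (simp only: diff_0_right)
          then show ?thesis by (rule has_field_derivative_at_within)
        qed
        have "cmod (g z * q z - s * z) \<le> \<epsilon> / 2 * cmod z" by (rule bd) (use z w in simp)
        also have "\<dots> \<le> \<epsilon> / 2 * cmod w" using z \<epsilon> by (intro mult_left_mono) auto
        finally show "cmod (g z * q z - s * z) \<le> \<epsilon> / 2 * cmod w" .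
      qed auto
      moreover have "H 0 = 0" by (simp add: H_def g0)
      ultimately have "cmod (H w) \<le> \<epsilon> / 2 * (cmod w)\<^sup>2" by (simp add: power2_eq_square)
      then have "cmod (H w) / (cmod w)\<^sup>2 \<le> \<epsilon> / 2" using w by (simp add: divide_le_eq)
      moreover have "(g w - 1) / w\<^sup>2 - of_real (log_laplace'' t / 2) = H w / w\<^sup>2"
        using w by (simp add: H_def s_def diff_divide_distrib)
      ultimately have "cmod ((g w - 1) / w\<^sup>2 - of_real (log_laplace'' t / 2)) \<le> \<epsilon> / 2"
        by (simp only: norm_divide norm_power)
      then show "cmod ((g w - 1) / w\<^sup>2 - of_real (log_laplace'' t / 2)) < \<epsilon>" using \<epsilon> by linarith
    qed
  qed
qed

text \<open>The central limit theorem for the tilted law. For numbers of modulus at most 1 the n-th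
  powers differ by at most n times the difference, so it suffices that n (\<psi> n - 1) and n (z n -
  1) have the same limit, where z n is the n-th root of the Gaussian limit.\<close>

lemma tilted_char_power_tendsto:
  assumes t: "t > 0"
  shows "(\<lambda>n. (exp (- \<i> * of_real (log_laplace' t * (v / sqrt (real n)))) * tilted_char t (v / sqrt (real n))) ^ n)
    \<longlonglongrightarrow> of_real (exp (- (log_laplace'' t * v\<^sup>2 / 2)))"
proof -
  define x where "x = log_laplace' t"
  define s where "s = log_laplace'' t"
  define g where "g w = exp (- of_real x * w) * ((exp (of_real t + w) - 1) / (of_real t + w)) / of_real ((exp t - 1) / t)" for w :: complex
  define w where "w n = \<i> * of_real (v / sqrt (real n))" for n :: nat
  define \<psi> where "\<psi> n = exp (- \<i> * of_real (x * (v / sqrt (real n)))) * tilted_char t (v / sqrt (real n))" for n :: nat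
  define z where "z n = complex_of_real (exp (- (s * v\<^sup>2 / 2) / real n))" for n :: nat
  have s: "s > 0" using log_laplace''_pos[OF t] by (simp add: s_def)
  have \<psi>: "\<psi> n = g (w n)" for n
    by (simp add: \<psi>_def g_def w_def tilted_char_def Complex_eq mult_ac)
  have lim: "((\<lambda>w. (g w - 1) / w\<^sup>2) \<longlongrightarrow> of_real (s / 2)) (at 0)"
    using second_order_limit[OF t] unfolding g_def x_def s_def by simp
  have w0: "w \<longlonglongrightarrow> 0"
  proof -
    have "(\<lambda>n. v / sqrt (real n)) \<longlonglongrightarrow> 0"
      by (intro tendsto_divide_0[OF tendsto_const] filterlim_at_top_imp_at_infinity
          filterlim_compose[OF sqrt_at_top filterlim_real_sequentially])
    then have "(\<lambda>n. \<i> * of_real (v / sqrt (real n))) \<longlonglongrightarrow> \<i> * of_real 0"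
      by (intro tendsto_intros)
    then show ?thesis by (simp add: w_def[abs_def])
  qed
  have n1: "(\<lambda>n. of_nat n * (\<psi> n - 1)) \<longlonglongrightarrow> of_real (- (s * v\<^sup>2 / 2))"
  proof (cases "v = 0")
    case True
    then have "\<psi> n = 1" for n using t by (simp add: \<psi>_def tilted_char_def Complex_eq exp_of_real)
    then show ?thesis using True by simp
  next
    case False
    have "eventually (\<lambda>n. w n \<noteq> 0) sequentially"
      using eventually_gt_at_top[of 0] by eventually_elim (use False in \<open>simp add: w_def\<close>)
    then have "filterlim w (at 0) sequentially" using w0 by (simp add: filterlim_at)
    from filterlim_compose[OF lim this]
    have "(\<lambda>n. (g (w n) - 1) / (w n)\<^sup>2 * of_real (- v\<^sup>2)) \<longlonglongrightarrow> of_real (s / 2) * of_real (- v\<^sup>2)"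
      by (intro tendsto_intros)
    moreover have "eventually (\<lambda>n. (g (w n) - 1) / (w n)\<^sup>2 * of_real (- v\<^sup>2) = of_nat n * (\<psi> n - 1)) sequentially"
      using eventually_gt_at_top[of 0]
    proof eventually_elim
      case (elim n)
      have w2: "(w n)\<^sup>2 = - of_real (v\<^sup>2) / of_nat n"
      proof -
        have "(v / sqrt (real n))\<^sup>2 = v\<^sup>2 / real n" by (simp add: power_divide)
        then show ?thesis unfolding w_def power_mult_distrib of_real_power[symmetric] by simp
      qed
      show ?case unfolding w2 \<psi> using elim False by (simp add: field_simps)
    qed
    ultimately have "(\<lambda>n. of_nat n * (\<psi> n - 1)) \<longlonglongrightarrow> of_real (s / 2) * of_real (- v\<^sup>2)"
      by (rule Lim_transform_eventually)
    then show ?thesis by simp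
  qed
  have n2: "(\<lambda>n. of_nat n * (z n - 1)) \<longlonglongrightarrow> of_real (- (s * v\<^sup>2 / 2))"
  proof -
    have "(\<lambda>n. real n * (exp (r / real n) - 1)) \<longlonglongrightarrow> r" for r by real_asymp
    from tendsto_of_real[OF this[of "- (s * v\<^sup>2 / 2)"], where 'a = complex]
    show ?thesis by (simp add: z_def)
  qed
  have "(\<lambda>n. \<psi> n ^ n - z n ^ n) \<longlonglongrightarrow> 0"
  proof (rule Lim_null_comparison)
    show "(\<lambda>n. norm (of_nat n * (\<psi> n - 1) - of_nat n * (z n - 1))) \<longlonglongrightarrow> 0"
      using tendsto_norm[OF tendsto_diff[OF n1 n2]] by simp
    show "eventually (\<lambda>n. norm (\<psi> n ^ n - z n ^ n) \<le> norm (of_nat n * (\<psi> n - 1) - of_nat n * (z n - 1))) sequentially"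
    proof (intro always_eventually allI)
      fix n
      obtain c where c: "c > 0" "\<And>u. (cmod (tilted_char t u))\<^sup>2 \<le> 1 / (1 + c * u\<^sup>2)"
        using tilted_char_decay[OF t] by blast
      have "(cmod (tilted_char t u))\<^sup>2 \<le> 1\<^sup>2" for u
      proof -
        have "c * u\<^sup>2 \<ge> 0" using c(1) by simp
        then have "1 / (1 + c * u\<^sup>2) \<le> 1" by (simp add: divide_le_eq_1)
        then show ?thesis using c(2)[of u] by simp
      qed
      then have "cmod (tilted_char t u) \<le> 1" for u by (rule power2_le_imp_le) simp
      then have "norm (\<psi> n) \<le> 1" by (simp add: \<psi>_def norm_mult)
      moreover have "norm (z n) \<le> 1" using s by (simp add: z_def)
      ultimately have "norm (\<psi> n ^ n - z n ^ n) \<le> real n * norm (\<psi> n - z n)" by (rule norm_power_diff)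
      also have "\<dots> = norm (of_nat n * (\<psi> n - 1) - of_nat n * (z n - 1))"
      proof -
        have "of_nat n * (\<psi> n - 1) - of_nat n * (z n - 1) = of_nat n * (\<psi> n - z n)" by (simp add: algebra_simps)
        then show ?thesis by (simp add: norm_mult)
      qed
      finally show "norm (\<psi> n ^ n - z n ^ n) \<le> norm (of_nat n * (\<psi> n - 1) - of_nat n * (z n - 1))" .
    qed
  qed
  moreover have "eventually (\<lambda>n. z n ^ n = of_real (exp (- (s * v\<^sup>2 / 2)))) sequentially"
    using eventually_gt_at_top[of 0]
  proof eventually_elim
    case (elim n)
    have "exp (- (s * v\<^sup>2 / 2) / real n) ^ n = exp (real n * (- (s * v\<^sup>2 / 2) / real n))"
      by (rule exp_of_nat_mult[symmetric])
    also have "real n * (- (s * v\<^sup>2 / 2) / real n) = - (s * v\<^sup>2 / 2)" using elim by simp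
    finally show ?case by (simp only: z_def of_real_power[symmetric])
  qed
  then have "(\<lambda>n. z n ^ n) \<longlonglongrightarrow> of_real (exp (- (s * v\<^sup>2 / 2)))" by (rule tendsto_eventually)
  ultimately have "(\<lambda>n. (\<psi> n ^ n - z n ^ n) + z n ^ n) \<longlonglongrightarrow> 0 + of_real (exp (- (s * v\<^sup>2 / 2)))"
    by (rule tendsto_add)
  then show ?thesis by (simp add: \<psi>_def x_def s_def)
qed

text \<open>The threshold differs from n x by a bounded rounding error \<theta>. On the line it
  contributes only the phase exp (i \<theta> v / sqrt n), which tends to 1; its lasting effect sits
  in the prefactor exp (- a t).\<close>

lemma saddle_kernel_tendsto:
  assumes t: "t > 0" and \<theta>: "\<And>n. \<bar>\<theta> n\<bar> \<le> 1"
  shows "(\<lambda>n. saddle_kernel t (real n * log_laplace' t - \<theta> n) n j v)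
    \<longlonglongrightarrow> of_real (exp (- (log_laplace'' t * v\<^sup>2 / 2)) * (t ^ j / t))"
proof -
  have v0: "(\<lambda>n. v / sqrt (real n)) \<longlonglongrightarrow> 0"
    by (intro tendsto_divide_0[OF tendsto_const] filterlim_at_top_imp_at_infinity
        filterlim_compose[OF sqrt_at_top filterlim_real_sequentially])
  have "(\<lambda>n. \<theta> n * (v / sqrt (real n))) \<longlonglongrightarrow> 0"
  proof (rule Lim_null_comparison)
    show "eventually (\<lambda>n. norm (\<theta> n * (v / sqrt (real n))) \<le> \<bar>v / sqrt (real n)\<bar>) sequentially"
    proof (intro always_eventually allI)
      fix n
      show "norm (\<theta> n * (v / sqrt (real n))) \<le> \<bar>v / sqrt (real n)\<bar>"
        using mult_right_mono[OF \<theta>[of n] abs_ge_zero[of "v / sqrt (real n)"]]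
        by (simp only: real_norm_def abs_mult mult_1)
    qed
    show "(\<lambda>n. \<bar>v / sqrt (real n)\<bar>) \<longlonglongrightarrow> 0" using tendsto_rabs[OF v0] by simp
  qed
  then have 1: "(\<lambda>n. exp (\<i> * of_real (\<theta> n * (v / sqrt (real n))))) \<longlonglongrightarrow> exp (\<i> * of_real 0)"
    by (intro tendsto_intros)
  have "(\<lambda>n. of_real t + \<i> * of_real (v / sqrt (real n))) \<longlonglongrightarrow> of_real t + \<i> * of_real 0"
    by (intro tendsto_intros v0)
  then have "(\<lambda>n. Complex t (v / sqrt (real n))) \<longlonglongrightarrow> of_real t" by (simp add: Complex_eq)
  then have 2: "(\<lambda>n. Complex t (v / sqrt (real n)) ^ j / Complex t (v / sqrt (real n))) \<longlonglongrightarrow> of_real t ^ j / of_real t"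
    using t by (intro tendsto_intros) auto
  have "saddle_kernel t (real n * log_laplace' t - \<theta> n) n j v =
    (exp (- \<i> * of_real (log_laplace' t * (v / sqrt (real n)))) * tilted_char t (v / sqrt (real n))) ^ n *
    exp (\<i> * of_real (\<theta> n * (v / sqrt (real n)))) *
    (Complex t (v / sqrt (real n)) ^ j / Complex t (v / sqrt (real n)))" for n
  proof -
    define u where "u = v / sqrt (real n)"
    have "exp (- \<i> * of_real ((real n * log_laplace' t - \<theta> n) * u)) =
        exp (- \<i> * of_real (log_laplace' t * u)) ^ n * exp (\<i> * of_real (\<theta> n * u))"
      unfolding exp_of_nat_mult[symmetric] exp_add[symmetric] by (simp add: algebra_simps)
    then show ?thesis
      unfolding saddle_kernel_def Let_def u_def[symmetric] power_mult_distrib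
      by (simp only: mult_ac times_divide_eq_right times_divide_eq_left)
  qed
  moreover have "(\<lambda>n. (exp (- \<i> * of_real (log_laplace' t * (v / sqrt (real n)))) * tilted_char t (v / sqrt (real n))) ^ n *
    exp (\<i> * of_real (\<theta> n * (v / sqrt (real n)))) *
    (Complex t (v / sqrt (real n)) ^ j / Complex t (v / sqrt (real n))))
    \<longlonglongrightarrow> of_real (exp (- (log_laplace'' t * v\<^sup>2 / 2))) * exp (\<i> * of_real 0) * (of_real t ^ j / of_real t)"
    by (intro tendsto_mult tilted_char_power_tendsto t 1 2)
  ultimately show ?thesis by simp
qed

lemma saddle_kernel_measurable:
  assumes "t > 0"
  shows "saddle_kernel t a n j \<in> borel_measurable lborel"
proof -
  define Z where "Z v = Complex t (v / sqrt (real n))" for v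
  have Z: "continuous_on UNIV Z"
    unfolding Z_def[abs_def] Complex_eq divide_inverse by (intro continuous_intros)
  have nz: "Z v \<noteq> 0" for v using assms by (simp add: Z_def complex_eq_iff)
  have M: "complex_of_real ((exp t - 1) / t) \<noteq> 0" using assms by simp
  define K where "K v = exp (- \<i> * of_real (a * (v / sqrt (real n))))" for v
  have K: "continuous_on UNIV K"
    unfolding K_def[abs_def] divide_inverse by (intro continuous_intros)
  have "continuous_on UNIV (\<lambda>v. ((exp (Z v) - 1) / Z v / of_real ((exp t - 1) / t)) ^ n * K v * Z v ^ j / Z v)"
    by (intro continuous_on_mult continuous_on_divide continuous_on_power continuous_on_diff
        continuous_on_exp continuous_on_const Z K ballI M nz)
  then have "continuous_on UNIV (saddle_kernel t a n j)"
    by (simp only: saddle_kernel_def[abs_def] Let_def tilted_char_def Z_def K_def)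
  then show ?thesis by (simp add: borel_measurable_continuous_onI)
qed

lemma gaussian_integral:
  assumes "s > 0"
  shows "(\<integral>v. exp (- (s * v\<^sup>2 / 2)) \<partial>lborel) = sqrt (2 * pi / s)"
proof -
  have "exp (- (s * v\<^sup>2 / 2)) = sqrt (2 * pi / s) * normal_density 0 (1 / sqrt s) v" for v
    using assms by (simp add: normal_density_def real_sqrt_divide power_divide field_simps)
  then show ?thesis using assms by (simp add: integral_normal_density)
qed

lemma saddle_integral_tendsto:
  assumes t: "t > 0" and \<theta>: "\<And>n. \<bar>\<theta> n\<bar> \<le> 1"
  shows "(\<lambda>n. \<integral>v. saddle_kernel t (real n * log_laplace' t - \<theta> n) n j v \<partial>lborel)
    \<longlonglongrightarrow> of_real (sqrt (2 * pi / log_laplace'' t) * (t ^ j / t))"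
proof -
  obtain c C where c: "c > 0" "C \<ge> 1"
    "\<And>a n j v. n \<ge> 2 \<Longrightarrow> j < n \<Longrightarrow> cmod (saddle_kernel t a n j v) \<le> C ^ Suc j * (1 / (1 + c / real (Suc j) * v\<^sup>2))"
    using saddle_kernel_bound[OF t] by blast
  let ?k = "\<lambda>n. saddle_kernel t (real n * log_laplace' t - \<theta> n) n j"
  let ?l = "\<lambda>v. complex_of_real (exp (- (log_laplace'' t * v\<^sup>2 / 2)) * (t ^ j / t))"
  \<comment> \<open>The shift by j + 2 puts every index into the range n \<ge> 2, j < n of the
    bound.\<close>
  have "(\<lambda>i. \<integral>v. ?k (i + (j + 2)) v \<partial>lborel) \<longlonglongrightarrow> (\<integral>v. ?l v \<partial>lborel)"
  proof (rule integral_dominated_convergence)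
    show "integrable lborel (\<lambda>v. C ^ Suc j * (1 / (1 + c / real (Suc j) * v\<^sup>2)))"
      using c by (intro integrable_mult_right integrable_inverse_quadratic) auto
    show "AE v in lborel. (\<lambda>i. ?k (i + (j + 2)) v) \<longlonglongrightarrow> ?l v"
      by (intro AE_I2 LIMSEQ_ignore_initial_segment[of "\<lambda>n. ?k n _"] saddle_kernel_tendsto t \<theta>)
    show "AE v in lborel. norm (?k (i + (j + 2)) v) \<le> C ^ Suc j * (1 / (1 + c / real (Suc j) * v\<^sup>2))" for i
      by (intro AE_I2 c) auto
  qed (use saddle_kernel_measurable[OF t] in auto)
  then have "(\<lambda>n. \<integral>v. ?k n v \<partial>lborel) \<longlonglongrightarrow> (\<integral>v. ?l v \<partial>lborel)" by (rule LIMSEQ_offset)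
  also have "(\<integral>v. ?l v \<partial>lborel) = of_real (sqrt (2 * pi / log_laplace'' t) * (t ^ j / t))"
    unfolding integral_complex_of_real using gaussian_integral[OF log_laplace''_pos[OF t]] by simp
  finally show ?thesis .
qed

text \<open>The majorant widens with j and costs a factor sqrt (j + 1), which doubling the geometric
  base absorbs.\<close>

lemma saddle_integral_bound:
  assumes t: "t > 0"
  obtains A B where "A \<ge> 0" "B \<ge> 0"
    "\<And>a n j. n \<ge> 2 \<Longrightarrow> j < n \<Longrightarrow> norm (\<integral>v. saddle_kernel t a n j v \<partial>lborel) \<le> A * B ^ j"
proof -
  obtain c C where c: "c > 0" "C \<ge> 1"
    "\<And>a n j v. n \<ge> 2 \<Longrightarrow> j < n \<Longrightarrow> cmod (saddle_kernel t a n j v) \<le> C ^ Suc j * (1 / (1 + c / real (Suc j) * v\<^sup>2))"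
    using saddle_kernel_bound[OF t] by blast
  have "norm (\<integral>v. saddle_kernel t a n j v \<partial>lborel) \<le> (C * pi / sqrt c) * (2 * C) ^ j" if n: "n \<ge> 2" "j < n" for a n j
  proof -
    have i: "integrable lborel (\<lambda>v. C ^ Suc j * (1 / (1 + c / real (Suc j) * v\<^sup>2)))"
      using c by (intro integrable_mult_right integrable_inverse_quadratic) auto
    have "integrable lborel (saddle_kernel t a n j)"
      by (rule Bochner_Integration.integrable_bound[OF i saddle_kernel_measurable[OF t]])
        (use order_trans[OF c(3)[OF n] abs_ge_self] in \<open>intro AE_I2, simp only: real_norm_def\<close>)
    then have "norm (\<integral>v. saddle_kernel t a n j v \<partial>lborel) \<le> (\<integral>v. C ^ Suc j * (1 / (1 + c / real (Suc j) * v\<^sup>2)) \<partial>lborel)"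
      by (intro Bochner_Integration.integral_norm_bound_integral i c(3)[OF n])
    also have "\<dots> = C ^ Suc j * (pi / sqrt (c / real (Suc j)))"
      using c by (simp only: integral_mult_right_zero integrable_inverse_quadratic(2) divide_pos_pos of_nat_0_less_iff zero_less_Suc)
    also have "\<dots> = C ^ Suc j * (pi / sqrt c) * sqrt (real (Suc j))"
      using c by (simp add: real_sqrt_divide)
    also have "\<dots> \<le> C ^ Suc j * (pi / sqrt c) * 2 ^ j"
    proof (rule mult_left_mono)
      have "Suc j \<le> 2 ^ j" by (induction j) auto
      then have "real (Suc j) \<le> 2 ^ j" using of_nat_mono[of "Suc j" "2 ^ j", where 'a = real] by simp
      moreover have "sqrt (real (Suc j)) \<le> real (Suc j)" by (rule real_le_lsqrt) (auto simp: power2_eq_square)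
      ultimately show "sqrt (real (Suc j)) \<le> 2 ^ j" by simp
    qed (use c in auto)
    finally show ?thesis by (simp add: power_mult_distrib mult_ac)
  qed
  moreover have "C * pi / sqrt c \<ge> 0" "2 * C \<ge> 0" using c by auto
  ultimately show ?thesis using that by blast
qed

subsection \<open>Stirling numbers near the diagonal\<close>

text \<open>Normalised so that the weights converge for fixed \<open>j\<close>: the Stirling number grows like \<open>n\<^sup>2\<^sup>j\<close>.\<close>

definition stirling_weight :: "nat \<Rightarrow> nat \<Rightarrow> real" where
  "stirling_weight n j = real (stirling n (n - j)) * (fact (n - j) / fact n)\<^sup>2"

text \<open>Mean value bounds for a unit step; with k + 1 = 2 j they drive the induction in
  \<open>stirling_corank_bounds\<close>.\<close>

lemma power_Suc_increment_bounds:
  fixes y :: real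
  assumes "y \<ge> 0"
  shows "y ^ Suc k + real (Suc k) * y ^ k \<le> (y + 1) ^ Suc k"
    and "(y + 1) ^ Suc k \<le> y ^ Suc k + real (Suc k) * (y + 1) ^ k"
proof -
  show "y ^ Suc k + real (Suc k) * y ^ k \<le> (y + 1) ^ Suc k"
  proof (induction k)
    case (Suc k)
    have "y ^ Suc (Suc k) + real (Suc (Suc k)) * y ^ Suc k \<le> (y + 1) * (y ^ Suc k + real (Suc k) * y ^ k)"
      using assms by (simp add: algebra_simps)
    also have "\<dots> \<le> (y + 1) * (y + 1) ^ Suc k" using Suc assms by (intro mult_left_mono) auto
    finally show ?case by simp
  qed simp
  show "(y + 1) ^ Suc k \<le> y ^ Suc k + real (Suc k) * (y + 1) ^ k"
  proof (induction k)
    case (Suc k)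
    have "(y + 1) ^ Suc (Suc k) = y * (y + 1) ^ Suc k + (y + 1) ^ Suc k" by (simp add: algebra_simps)
    also have "\<dots> \<le> y * (y ^ Suc k + real (Suc k) * (y + 1) ^ k) + (y + 1) ^ Suc k"
      using Suc assms by (intro add_mono mult_left_mono) auto
    also have "\<dots> \<le> y ^ Suc (Suc k) + real (Suc k) * (y + 1) ^ Suc k + (y + 1) ^ Suc k"
      using assms by (simp add: algebra_simps)
    finally show ?case by (simp add: algebra_simps)
  qed simp
qed

text \<open>For j = i + 1 the Stirling recurrence says that the increment in n at corank j is n
  times the number at corank i. The function n^(2j) / (2^j j!) solves the continuous version: its
  derivative is n times the same function for i. The bounds absorb the discretisation.\<close>

lemma stirling_corank_bounds:
  assumes "j \<le> n"
  shows "real (stirling n (n - j)) \<le> real n ^ (2 * j) / (2 ^ j * fact j)"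
    and "(real n - real j) ^ (2 * j) / (2 ^ j * fact j) \<le> real (stirling n (n - j))"
proof -
  have "real (stirling n (n - j)) \<le> real n ^ (2 * j) / (2 ^ j * fact j) \<and>
    (real n - real j) ^ (2 * j) / (2 ^ j * fact j) \<le> real (stirling n (n - j))"
    using assms
  proof (induction n arbitrary: j)
    case (Suc n)
    consider "j = 0" | "j = Suc n" | i where "j = Suc i" "j \<le> n"
      using Suc.prems by (cases j) (auto simp: le_Suc_eq)
    then show ?case
    proof cases
      case 3
      define d where "d = 2 ^ j * (fact j :: real)"
      have d: "d > 0" "d = 2 * real j * (2 ^ i * fact i)" using 3 by (auto simp: d_def)
      have st: "real (stirling (Suc n) (Suc n - j)) = real n * real (stirling n (n - i)) + real (stirling n (n - j))"
      proof -
        have "Suc n - j = Suc (n - j)" "n - i = Suc (n - j)" using 3 by auto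
        then show ?thesis by simp
      qed
      have i: "real n * (c / (2 ^ i * fact i)) = 2 * real j * real n * c / d" for c
        using 3 d by (simp add: field_simps)
      have le: "i \<le> n" using 3 by simp
      note IHi = Suc.IH[OF le] and IHj = Suc.IH[OF 3(2), folded d_def]
      have "real n * real (stirling n (n - i)) + real (stirling n (n - j)) \<le> real n * (real n ^ (2 * i) / (2 ^ i * fact i)) + real n ^ (2 * j) / d"
        using IHi IHj by (intro add_mono mult_left_mono) auto
      also have "\<dots> = (real n ^ Suc (2 * i + 1) + real (Suc (2 * i + 1)) * real n ^ (2 * i + 1)) / d"
        unfolding i using 3 by (simp add: add_divide_distrib algebra_simps)
      also have "\<dots> \<le> (real n + 1) ^ Suc (2 * i + 1) / d"
        using d by (intro divide_right_mono power_Suc_increment_bounds) auto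
      finally have 1: "real (stirling (Suc n) (Suc n - j)) \<le> real (Suc n) ^ (2 * j) / d"
        unfolding st using 3 by (simp add: add.commute)
      \<comment> \<open>y + 1 is both n + 1 - j, the base of the claim at n + 1, and n - i, the base
        in the induction hypothesis for i.\<close>
      define y where "y = real n - real j"
      have y: "y \<ge> 0" "y + 1 \<le> real n" using 3 by (auto simp: y_def)
      have "(y + 1) ^ Suc (2 * i + 1) / d \<le> (y ^ Suc (2 * i + 1) + real (Suc (2 * i + 1)) * (y + 1) ^ (2 * i + 1)) / d"
        using d y by (intro divide_right_mono power_Suc_increment_bounds) auto
      also have "\<dots> \<le> (y ^ (2 * j) + 2 * real j * real n * (y + 1) ^ (2 * i)) / d"
      proof -
        have "(y + 1) ^ (2 * i) * (y + 1) \<le> (y + 1) ^ (2 * i) * real n" using y by (intro mult_left_mono) auto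
        then have "2 * real j * ((y + 1) ^ (2 * i) * (y + 1)) \<le> 2 * real j * ((y + 1) ^ (2 * i) * real n)"
          by (rule mult_left_mono) simp
        then show ?thesis using d 3 by (intro divide_right_mono) (auto simp: mult_ac)
      qed
      also have "\<dots> = real n * ((y + 1) ^ (2 * i) / (2 ^ i * fact i)) + y ^ (2 * j) / d"
        unfolding i by (simp add: add_divide_distrib)
      also have "\<dots> \<le> real n * real (stirling n (n - i)) + real (stirling n (n - j))"
      proof -
        have y': "y + 1 = real n - real i" using 3 by (simp add: y_def)
        show ?thesis unfolding y' unfolding y_def using IHi IHj by (intro add_mono mult_left_mono) auto
      qed
      finally have 2: "(real (Suc n) - real j) ^ (2 * j) / d \<le> real (stirling (Suc n) (Suc n - j))"
        unfolding st using 3 by (simp add: y_def algebra_simps)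
      show ?thesis using 1 2 by (simp only: d_def)
    qed simp_all
  qed simp
  then show "real (stirling n (n - j)) \<le> real n ^ (2 * j) / (2 ^ j * fact j)"
    "(real n - real j) ^ (2 * j) / (2 ^ j * fact j) \<le> real (stirling n (n - j))" by auto
qed

lemma fact_quotient_bounds:
  assumes "j \<le> n"
  shows "fact n \<le> real n ^ j * fact (n - j)" and "(real n - real j) ^ j * fact (n - j) \<le> fact n"
proof -
  have "fact n \<le> real n ^ j * fact (n - j) \<and> (real n - real j) ^ j * fact (n - j) \<le> fact n"
    using assms
  proof (induction j)
    case (Suc j)
    have f: "fact (n - j) = real (n - j) * fact (n - Suc j)"
      using Suc.prems fact_reduce[of "n - j", where 'a = real] by (simp add: Suc_diff_Suc)
    have "fact n \<le> real n ^ j * fact (n - j)" using Suc by simp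
    also have "\<dots> = real n ^ j * fact (n - Suc j) * real (n - j)" using f by (simp add: mult_ac)
    also have "\<dots> \<le> real n ^ j * fact (n - Suc j) * real n" by (intro mult_left_mono) auto
    finally have 1: "fact n \<le> real n ^ Suc j * fact (n - Suc j)" by (simp add: mult_ac)
    have "(real n - real (Suc j)) ^ Suc j * fact (n - Suc j) = (real n - real (Suc j)) ^ j * ((real n - real (Suc j)) * fact (n - Suc j))"
      by simp
    also have "\<dots> \<le> (real n - real j) ^ j * (real (n - j) * fact (n - Suc j))"
      using Suc.prems by (intro mult_mono power_mono) auto
    also have "\<dots> \<le> fact n" using Suc by (simp add: f)
    finally show ?case using 1 by simp
  qed simp
  then show "fact n \<le> real n ^ j * fact (n - j)" "(real n - real j) ^ j * fact (n - j) \<le> fact n" by auto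
qed

lemma power_self_le_exp: "real j ^ j \<le> exp (real j) * fact j"
proof -
  have s: "(\<lambda>i. real j ^ i /\<^sub>R fact i) sums exp (real j)" by (rule exp_converges)
  have "(\<Sum>i\<in>{j}. real j ^ i /\<^sub>R fact i) \<le> suminf (\<lambda>i. real j ^ i /\<^sub>R fact i)"
    by (rule sum_le_suminf) (use s in \<open>auto simp: sums_iff\<close>)
  then show ?thesis using s by (simp add: sums_iff field_simps)
qed

text \<open>For j of order n the quotient n^j (n - j)! / n! need not be close to 1. Comparing (n /
  j)^j with the binomial coefficient, and j^j / j! with the exponential series, keeps it at most
  geometric in j.\<close>

lemma power_le_exp_fact_quotient:
  assumes "j \<le> n"
  shows "real n ^ j * fact (n - j) \<le> exp (real j) * fact n"
proof (cases "j = 0")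
  case False
  have "(real n / real j) ^ j \<le> real (n choose j)" by (rule binomial_ge_n_over_k_pow_k[OF assms])
  also have "\<dots> = fact n / (fact j * fact (n - j))" by (rule binomial_fact[OF assms])
  finally have "real n ^ j * fact (n - j) \<le> real j ^ j * fact n / fact j"
    using False by (simp add: power_divide field_simps)
  also have "\<dots> \<le> exp (real j) * fact j * fact n / fact j"
    using power_self_le_exp by (intro divide_right_mono mult_right_mono) auto
  finally show ?thesis by simp
qed simp

text \<open>Uniformly in n the weight retains 1/j!, which beats the geometric growth of the
  integrals.\<close>

lemma stirling_weight_le:
  assumes "j < n"
  shows "0 \<le> stirling_weight n j" and "stirling_weight n j \<le> exp 2 ^ j / (2 ^ j * fact j)"
proof -
  show "0 \<le> stirling_weight n j" by (simp add: stirling_weight_def)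
  have "stirling_weight n j \<le> real n ^ (2 * j) / (2 ^ j * fact j) * (fact (n - j) / fact n)\<^sup>2"
    unfolding stirling_weight_def using stirling_corank_bounds[of j n] assms by (intro mult_right_mono) auto
  also have "\<dots> = (real n ^ j * fact (n - j) / fact n)\<^sup>2 / (2 ^ j * fact j)"
    by (simp add: power_mult_distrib power_divide mult.commute[of 2 j] power_mult)
  also have "\<dots> \<le> (exp (real j))\<^sup>2 / (2 ^ j * fact j)"
    using power_le_exp_fact_quotient[of j n] assms
    by (intro divide_right_mono power_mono) (auto simp: divide_le_eq)
  also have "(exp (real j))\<^sup>2 = exp 2 ^ j"
    by (simp add: mult.commute flip: exp_of_nat_mult exp_double)
  finally show "stirling_weight n j \<le> exp 2 ^ j / (2 ^ j * fact j)" .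
qed

lemma stirling_weight_tendsto: "(\<lambda>n. stirling_weight n j) \<longlonglongrightarrow> 1 / (2 ^ j * fact j)"
proof (rule tendsto_sandwich)
  let ?d = "2 ^ j * fact j :: real"
  show "eventually (\<lambda>n. ((real n - real j) / real n) ^ (2 * j) / ?d \<le> stirling_weight n j) sequentially"
    using eventually_gt_at_top[of j]
  proof eventually_elim
    case (elim n)
    have "1 / real n ^ j \<le> fact (n - j) / fact n"
      using fact_quotient_bounds(1)[of j n] elim by (simp add: field_simps)
    then have "(1 / real n ^ j)\<^sup>2 \<le> (fact (n - j) / fact n)\<^sup>2" by (intro power_mono) auto
    then have "(real n - real j) ^ (2 * j) / ?d * (1 / real n ^ j)\<^sup>2 \<le> stirling_weight n j"
      unfolding stirling_weight_def using stirling_corank_bounds(2)[of j n] elim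
      by (intro mult_mono) auto
    then show ?case by (simp add: power_divide power_mult[symmetric] mult.commute)
  qed
  show "eventually (\<lambda>n. stirling_weight n j \<le> (real n / (real n - real j)) ^ (2 * j) / ?d) sequentially"
    using eventually_gt_at_top[of j]
  proof eventually_elim
    case (elim n)
    have "fact (n - j) / fact n \<le> 1 / (real n - real j) ^ j"
      using fact_quotient_bounds(2)[of j n] elim by (simp add: field_simps)
    then have "(fact (n - j) / fact n)\<^sup>2 \<le> (1 / (real n - real j) ^ j)\<^sup>2" by (intro power_mono) auto
    then have "stirling_weight n j \<le> real n ^ (2 * j) / ?d * (1 / (real n - real j) ^ j)\<^sup>2"
      unfolding stirling_weight_def using stirling_corank_bounds(1)[of j n] elim
      by (intro mult_mono) auto
    then show ?case by (simp add: power_divide power_mult[symmetric] mult.commute)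
  qed
  have 1: "(\<lambda>n. (real n - real j) / real n) \<longlonglongrightarrow> 1" by real_asymp
  have 2: "(\<lambda>n. real n / (real n - real j)) \<longlonglongrightarrow> 1" by real_asymp
  show "(\<lambda>n. ((real n - real j) / real n) ^ (2 * j) / ?d) \<longlonglongrightarrow> 1 / ?d"
    using tendsto_divide[OF tendsto_power[OF 1, of "2 * j"] tendsto_const[of ?d]] by simp
  show "(\<lambda>n. (real n / (real n - real j)) ^ (2 * j) / ?d) \<longlonglongrightarrow> 1 / ?d"
    using tendsto_divide[OF tendsto_power[OF 2, of "2 * j"] tendsto_const[of ?d]] by simp
qed

subsection \<open>Joint tails\<close>

lemma descents_less: "n \<ge> 1 \<Longrightarrow> descents n \<sigma> < n"
proof -
  assume n: "n \<ge> 1"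
  have "descents n \<sigma> \<le> card {1..<n}" unfolding descents_def by (intro card_mono) auto
  then show ?thesis using n by simp
qed

text \<open>For d < n the lower tail is the mirror image of the upper one under d -> n - 1 - d,
  written in the form that \<open>sum_descents_less\<close> counts.\<close>

definition in_tail :: "bool \<Rightarrow> nat \<Rightarrow> nat \<Rightarrow> nat \<Rightarrow> bool" where
  "in_tail upper n a d \<longleftrightarrow> (if upper then a \<le> d else d < n - a)"

text \<open>An upper tail is [d < n] - [d < a], which brings in the difference evaluated by
  \<open>irwin_hall_complement\<close>: it equals the lower tail up to the sign (-1)^j in the j-th
  term. Two upper tails cancel these signs, a single one leaves them.\<close>

lemma card_tails:
  fixes s r :: bool
  assumes n: "n \<ge> 1" and ab: "a \<le> n" "b \<le> n"
  defines "\<epsilon> \<equiv> (if s = r then 1 else - 1 :: real)"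
  shows "real (card {\<sigma>. \<sigma> permutes {1..n} \<and> in_tail s n a (descents n \<sigma>) \<and> in_tail r n b (descents n (inv \<sigma>))}) =
    (\<Sum>j<n. \<epsilon> ^ j * (real (stirling n (n - j)) / fact n * irwin_hall n (n - j) (n - a) * irwin_hall n (n - j) (n - b)))"
proof -
  define U where "U s a m = (if s then irwin_hall n m n - irwin_hall n m a else irwin_hall n m (n - a))" for s a m
  define f where "f s a d = (if s then of_bool (d < n) - of_bool (d < a) else of_bool (d < n - a) :: real)" for s a d
  have f: "of_bool (in_tail s n a d) = f s a d" if "d < n" for s a d
    using that by (auto simp: f_def in_tail_def)
  let ?S = "{\<sigma>. \<sigma> permutes {1..n}}"
  have sum: "(\<Sum>\<sigma>\<in>?S. f s a (descents n \<sigma>) * f r b (descents n (inv \<sigma>))) = (\<Sum>m\<le>n. real (stirling n m) / fact n * U s a m * U r b m)"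
  proof -
    note S = sum_descents_less[OF n]
    show ?thesis
      by (cases s; cases r)
        (simp_all add: f_def U_def left_diff_distrib right_diff_distrib sum_subtractf S flip: One_nat_def)
  qed
  have "{\<sigma>. \<sigma> permutes {1..n} \<and> in_tail s n a (descents n \<sigma>) \<and> in_tail r n b (descents n (inv \<sigma>))} =
    {\<sigma> \<in> ?S. in_tail s n a (descents n \<sigma>) \<and> in_tail r n b (descents n (inv \<sigma>))}" by simp
  then have "real (card {\<sigma>. \<sigma> permutes {1..n} \<and> in_tail s n a (descents n \<sigma>) \<and> in_tail r n b (descents n (inv \<sigma>))}) =
    (\<Sum>\<sigma>\<in>{\<sigma> \<in> ?S. in_tail s n a (descents n \<sigma>) \<and> in_tail r n b (descents n (inv \<sigma>))}. 1)"
    by simp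
  also have "\<dots> = (\<Sum>\<sigma>\<in>?S. if in_tail s n a (descents n \<sigma>) \<and> in_tail r n b (descents n (inv \<sigma>)) then 1 else 0)"
    by (rule sum.inter_filter) (simp add: finite_permutations)
  also have "\<dots> = (\<Sum>\<sigma>\<in>?S. f s a (descents n \<sigma>) * f r b (descents n (inv \<sigma>)))"
    by (intro sum.cong refl) (simp add: descents_less[OF n] flip: f)
  also have "\<dots> = (\<Sum>m\<le>n. real (stirling n m) / fact n * U s a m * U r b m)" by (rule sum)
  \<comment> \<open>The term m = 0 has \<open>stirling n 0 = 0\<close>; both the complement formula
    and the contour integral require m \<ge> 1.\<close>
  also have "\<dots> = (\<Sum>m\<in>{1..n}. real (stirling n m) / fact n * U s a m * U r b m)"
    using n by (intro sum.mono_neutral_right) (auto simp: not_less_eq_eq)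
  also have "\<dots> = (\<Sum>j<n. \<epsilon> ^ j * (real (stirling n (n - j)) / fact n * irwin_hall n (n - j) (n - a) * irwin_hall n (n - j) (n - b)))"
  proof (rule sum.reindex_bij_witness[of _ "\<lambda>j. n - j" "\<lambda>m. n - m"])
    fix m assume m: "m \<in> {1..n}"
    have U: "U s c m = (if s then (-1) ^ (n - m) else 1) * irwin_hall n m (n - c)" if "c \<le> n" for s c
      using irwin_hall_complement[OF that, of m] m by (simp add: U_def)
    have "(-1) ^ k * ((-1) ^ k * c) = (c :: real)" for k c
      by (simp flip: mult.assoc power_mult_distrib)
    then show "\<epsilon> ^ (n - m) * (real (stirling n (n - (n - m))) / fact n * irwin_hall n (n - (n - m)) (n - a) * irwin_hall n (n - (n - m)) (n - b)) =
      real (stirling n m) / fact n * U s a m * U r b m"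
      using m unfolding U[OF ab(1)] U[OF ab(2)] by (auto simp: \<epsilon>_def mult_ac)
  qed auto
  finally show ?thesis .
qed

section \<open>Integer thresholds and the limit of the series\<close>

definition threshold :: "real \<Rightarrow> nat \<Rightarrow> nat" where
  "threshold x n = nat \<lceil>(real n - 1) * x\<rceil>"

lemma threshold_properties:
  assumes x: "x \<in> {1/2<..<1}"
  shows "real n * x - real (threshold x n) = offset n x" and "\<bar>offset n x\<bar> \<le> 1"
    and "n \<ge> 1 \<Longrightarrow> threshold x n \<le> n"
    and "n \<ge> 2 \<Longrightarrow> d < n \<Longrightarrow> real d / (real n - 1) \<ge> x \<longleftrightarrow> in_tail True n (threshold x n) d"
    and "n \<ge> 2 \<Longrightarrow> d < n \<Longrightarrow> real d / (real n - 1) \<le> 1 - x \<longleftrightarrow> in_tail False n (threshold x n) d"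
proof -
  \<comment> \<open>This matters for n = 0, where the product is - x: the ceiling is still
    nonnegative and \<open>nat\<close> loses nothing.\<close>
  have "(real n - 1) * x > - 1"
  proof -
    have "- 1 < - x" using x by simp
    also have "\<dots> \<le> (real n - 1) * x" using x by (simp add: left_diff_distrib)
    finally show ?thesis .
  qed
  then have "\<lceil>(real n - 1) * x\<rceil> \<ge> 0" by linarith
  then have c: "real (threshold x n) = of_int \<lceil>(real n - 1) * x\<rceil>" by (simp add: threshold_def)
  then show "real n * x - real (threshold x n) = offset n x" by (simp add: offset_def)
  have "(real n - 1) * x \<le> of_int \<lceil>(real n - 1) * x\<rceil>" "of_int \<lceil>(real n - 1) * x\<rceil> < (real n - 1) * x + 1"
    by linarith+
  moreover have "\<bar>real n * x - c\<bar> \<le> 1" if "(real n - 1) * x \<le> c" "c < (real n - 1) * x + 1" for c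
    using that x by (auto simp: left_diff_distrib abs_le_iff)
  ultimately show "\<bar>offset n x\<bar> \<le> 1" unfolding offset_def by blast
  have iff: "threshold x n \<le> d \<longleftrightarrow> (real n - 1) * x \<le> real d" for d
    using c by (simp add: threshold_def nat_le_iff ceiling_le_iff)
  have le: "threshold x n \<le> n - 1" if "n \<ge> 1"
  proof -
    have "(real n - 1) * x \<le> (real n - 1) * 1" using x that by (intro mult_left_mono) auto
    then show ?thesis unfolding iff using that by (simp add: of_nat_diff)
  qed
  then show "n \<ge> 1 \<Longrightarrow> threshold x n \<le> n" by fastforce
  assume n: "n \<ge> 2" and d: "d < n"
  show "real d / (real n - 1) \<ge> x \<longleftrightarrow> in_tail True n (threshold x n) d"
    using n by (simp add: in_tail_def iff le_divide_eq mult.commute)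
  \<comment> \<open>Passing to n - 1 - d gives the upper tail condition, so both tails share one
    threshold and one rounding.\<close>
  have "real d / (real n - 1) \<le> 1 - x \<longleftrightarrow> (real n - 1) * x \<le> real (n - 1 - d)"
  proof -
    have "real d / (real n - 1) \<le> 1 - x \<longleftrightarrow> real d \<le> (1 - x) * (real n - 1)"
      using n by (intro pos_divide_le_eq) simp
    then show ?thesis using n d by (simp add: of_nat_diff algebra_simps)
  qed
  also have "\<dots> \<longleftrightarrow> d < n - threshold x n"
    unfolding iff[symmetric] using le n d by auto
  finally show "real d / (real n - 1) \<le> 1 - x \<longleftrightarrow> in_tail False n (threshold x n) d"
    by (simp add: in_tail_def)
qed

text \<open>Tannery's theorem applies because the factorial in the weights dominates the geometric
  factors; the limits of the terms form the exponential series of \<epsilon> p q / 2.\<close>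

lemma series_tendsto:
  fixes p q :: real and K L :: "nat \<Rightarrow> nat \<Rightarrow> complex"
  assumes K: "\<And>j. (\<lambda>n. K n j) \<longlonglongrightarrow> of_real (c * (p ^ j / p))"
    and L: "\<And>j. (\<lambda>n. L n j) \<longlonglongrightarrow> of_real (d * (q ^ j / q))"
    and Kb: "\<And>n j. n \<ge> 2 \<Longrightarrow> j < n \<Longrightarrow> norm (K n j) \<le> A * B ^ j" "A \<ge> 0" "B \<ge> 0"
    and Lb: "\<And>n j. n \<ge> 2 \<Longrightarrow> j < n \<Longrightarrow> norm (L n j) \<le> A' * B' ^ j" "A' \<ge> 0" "B' \<ge> 0"
    and \<epsilon>: "\<bar>\<epsilon>\<bar> \<le> 1"
  shows "(\<lambda>n. \<Sum>j<n. of_real (\<epsilon> ^ j * stirling_weight n j) * (K n j * L n j)) \<longlonglongrightarrow>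
    of_real (c * d / (p * q) * exp (\<epsilon> * (p * q) / 2))"
proof -
  define a where "a j n = (if j < n then of_real (\<epsilon> ^ j * stirling_weight n j) * (K n j * L n j) else 0)" for j n
  define b where "b j = complex_of_real (\<epsilon> ^ j * (1 / (2 ^ j * fact j)) * (c * (p ^ j / p) * (d * (q ^ j / q))))" for j
  define M where "M j = A * A' * ((exp 2 / 2 * B * B') ^ j /\<^sub>R fact j)" for j
  have lim: "(\<lambda>n. a j n) \<longlonglongrightarrow> b j" for j
  proof -
    have "(\<lambda>n. of_real (\<epsilon> ^ j * stirling_weight n j) * (K n j * L n j)) \<longlonglongrightarrow>
      of_real (\<epsilon> ^ j * (1 / (2 ^ j * fact j))) * (of_real (c * (p ^ j / p)) * of_real (d * (q ^ j / q)))"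
      by (intro tendsto_intros K L stirling_weight_tendsto)
    moreover have "eventually (\<lambda>n. of_real (\<epsilon> ^ j * stirling_weight n j) * (K n j * L n j) = a j n) sequentially"
      using eventually_gt_at_top[of j] by eventually_elim (simp add: a_def)
    ultimately show ?thesis unfolding b_def of_real_mult by (rule Lim_transform_eventually)
  qed
  have bound: "norm (a j n) \<le> M j" if n: "n \<ge> 2" for j n
  proof (cases "j < n")
    case True
    have "norm (a j n) = \<bar>\<epsilon>\<bar> ^ j * stirling_weight n j * (norm (K n j) * norm (L n j))"
      using True stirling_weight_le(1)[OF True] by (simp add: a_def norm_mult norm_power)
    also have "\<dots> \<le> 1 * (exp 2 ^ j / (2 ^ j * fact j)) * ((A * B ^ j) * (A' * B' ^ j))"
      using stirling_weight_le[OF True] \<epsilon> Kb Lb n True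
      by (intro mult_mono mult_nonneg_nonneg power_le_one) auto
    also have "\<dots> = M j" by (simp add: M_def power_mult_distrib power_divide field_simps)
    finally show ?thesis .
  next
    case False
    then show ?thesis using Kb Lb by (simp add: a_def M_def)
  qed
  have "((\<lambda>n. suminf (\<lambda>j. a j n)) \<longlonglongrightarrow> suminf b)"
  proof (rule tannerys_theorem[THEN conjunct2, THEN conjunct2])
    show "summable M" unfolding M_def by (intro summable_mult summable_exp_generic)
    have "eventually (\<lambda>z. True \<and> snd z \<ge> (2::nat)) (at_top \<times>\<^sub>F sequentially)"
      by (rule eventually_prodI) (auto intro: eventually_ge_at_top)
    then show "eventually (\<lambda>(j, n). norm (a j n) \<le> M j) (at_top \<times>\<^sub>F sequentially)"
      by eventually_elim (use bound in auto)
  qed (use lim in auto)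
  moreover have "suminf (\<lambda>j. a j n) = (\<Sum>j<n. of_real (\<epsilon> ^ j * stirling_weight n j) * (K n j * L n j))" for n
  proof -
    have "suminf (\<lambda>j. a j n) = (\<Sum>j<n. a j n)" by (rule suminf_finite) (auto simp: a_def)
    then show ?thesis by (simp add: a_def)
  qed
  moreover have "suminf b = of_real (c * d / (p * q) * exp (\<epsilon> * (p * q) / 2))"
  proof -
    have "(\<lambda>j. c * d / (p * q) * ((\<epsilon> * (p * q) / 2) ^ j /\<^sub>R fact j)) sums (c * d / (p * q) * exp (\<epsilon> * (p * q) / 2))"
      by (intro sums_mult exp_converges)
    then have "(\<lambda>j. complex_of_real (c * d / (p * q) * ((\<epsilon> * (p * q) / 2) ^ j /\<^sub>R fact j))) sums of_real (c * d / (p * q) * exp (\<epsilon> * (p * q) / 2))"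
      by (rule sums_of_real)
    moreover have "(\<lambda>j. complex_of_real (c * d / (p * q) * ((\<epsilon> * (p * q) / 2) ^ j /\<^sub>R fact j))) = b"
      unfolding b_def by (intro ext arg_cong[where f = complex_of_real])
        (simp add: power_mult_distrib power_divide field_simps)
    ultimately show ?thesis by (simp add: sums_iff)
  qed
  ultimately show ?thesis by simp
qed

text \<open>With a the threshold, t the tilt and L the log-Laplace transform, - a t + n L(t) = - n
  (x t - L(t)) + (n x - a) t: rounding to the lattice shows only in the offset.\<close>

lemma exp_rate:
  assumes x: "x \<in> {1/2<..<1}"
  shows "exp (- real (threshold x n) * tilt x) * ((exp (tilt x) - 1) / tilt x) ^ n =
    exp (- real n * rate x + offset n x * tilt x)"
proof -
  have t: "tilt x > 0" using tilt_properties[OF x] by simp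
  then have "((exp (tilt x) - 1) / tilt x) ^ n = exp (real n * log_laplace (tilt x))"
    using exp_minus_one_over_pos[of "tilt x"] by (simp add: exp_of_nat_mult log_laplace_def)
  then show ?thesis
    unfolding threshold_properties(1)[OF x, of n, symmetric] tilt_properties(4)[OF x]
    by (simp add: exp_add[symmetric] algebra_simps)
qed

text \<open>One 1/n! comes from the uniform law and one from \<open>sum_descents_less\<close>; with
  the factor (n - j)! of each contour integral they form \<open>stirling_weight\<close>.\<close>

lemma prob_tails:
  fixes s r :: bool
  assumes x: "x \<in> {1/2<..<1}" and y: "y \<in> {1/2<..<1}" and n: "n \<ge> 2"
  defines "\<epsilon> \<equiv> (if s = r then 1 else - 1 :: real)"
  shows "complex_of_real (measure_pmf.prob (uniform_perm n)
      {\<sigma>. in_tail s n (threshold x n) (descents n \<sigma>) \<and> in_tail r n (threshold y n) (descents n (inv \<sigma>))}) =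
    of_real (exp (- real n * rate2 x y + offset n x * tilt x + offset n y * tilt y) / (4 * pi\<^sup>2 * real n)) *
    (\<Sum>j<n. of_real (\<epsilon> ^ j * stirling_weight n j) *
      ((\<integral>v. saddle_kernel (tilt x) (real (threshold x n)) n j v \<partial>lborel) *
       (\<integral>v. saddle_kernel (tilt y) (real (threshold y n)) n j v \<partial>lborel)))"
proof -
  define a b where "a = threshold x n" and "b = threshold y n"
  have ab: "a \<le> n" "b \<le> n" using threshold_properties(3)[OF x, of n] threshold_properties(3)[OF y, of n] n by (auto simp: a_def b_def)
  have t: "tilt x > 0" "tilt y > 0" using tilt_properties x y by auto
  define K where "K x a j = (\<integral>v. saddle_kernel (tilt x) (real a) n j v \<partial>lborel)" for x a j
  define E where "E x = exp (- real n * rate x + offset n x * tilt x)" for x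
  have ih: "complex_of_real (irwin_hall n (n - j) (n - a)) = of_real (fact (n - j) * E x / (2 * pi * sqrt (real n))) * K x a j"
      "complex_of_real (irwin_hall n (n - j) (n - b)) = of_real (fact (n - j) * E y / (2 * pi * sqrt (real n))) * K y b j" if "j < n" for j
    using irwin_hall_saddle[OF t(1), of "n - j" n j a] irwin_hall_saddle[OF t(2), of "n - j" n j b]
      exp_rate[OF x, of n] exp_rate[OF y, of n] ab that
    by (simp_all only: K_def E_def a_def b_def)
  let ?A = "{\<sigma>. in_tail s n a (descents n \<sigma>) \<and> in_tail r n b (descents n (inv \<sigma>))}"
  have "measure_pmf.prob (uniform_perm n) ?A = real (card ({\<sigma>. \<sigma> permutes {1..n}} \<inter> ?A)) / fact n"
  proof -
    have S: "{\<sigma>. \<sigma> permutes {1..n}} \<noteq> {}" using permutes_id by blast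
    have F: "finite {\<sigma>. \<sigma> permutes {1..n}}" by (rule finite_permutations) simp
    have "card {\<sigma>. \<sigma> permutes {1..n}} = fact n" by (rule card_permutations) simp_all
    then show ?thesis
      unfolding uniform_perm_def measure_pmf_of_set[OF S F] by (simp only: of_nat_fact)
  qed
  also have "{\<sigma>. \<sigma> permutes {1..n}} \<inter> ?A = {\<sigma>. \<sigma> permutes {1..n} \<and> in_tail s n a (descents n \<sigma>) \<and> in_tail r n b (descents n (inv \<sigma>))}" by auto
  also have "real (card \<dots>) = (\<Sum>j<n. \<epsilon> ^ j * (real (stirling n (n - j)) / fact n * irwin_hall n (n - j) (n - a) * irwin_hall n (n - j) (n - b)))"
    unfolding \<epsilon>_def using n ab by (intro card_tails) auto
  finally have "complex_of_real (measure_pmf.prob (uniform_perm n) ?A) =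
      (\<Sum>j<n. of_real (\<epsilon> ^ j * real (stirling n (n - j)) / (fact n)\<^sup>2) * (of_real (irwin_hall n (n - j) (n - a)) * of_real (irwin_hall n (n - j) (n - b))))"
    by (simp add: sum_divide_distrib power2_eq_square mult_ac)
  also have "\<dots> = (\<Sum>j<n. of_real (E x * E y / (4 * pi\<^sup>2 * real n)) * (of_real (\<epsilon> ^ j * stirling_weight n j) * (K x a j * K y b j)))"
  proof (intro sum.cong refl)
    fix j assume "j \<in> {..<n}"
    then have j: "j < n" by simp
    have pull: "of_real c1 * ((of_real c2 * k) * (of_real c3 * l)) = of_real r1 * (of_real r2 * (k * l))"
      if "c1 * (c2 * c3) = r1 * r2" for c1 c2 c3 r1 r2 :: real and k l :: complex
    proof -
      have "of_real c1 * ((of_real c2 * k) * (of_real c3 * l)) = of_real (c1 * (c2 * c3)) * (k * l)"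
        by (simp add: mult_ac)
      also have "\<dots> = of_real r1 * (of_real r2 * (k * l))" unfolding that by (simp add: mult_ac)
      finally show ?thesis .
    qed
    have "c * S / F\<^sup>2 * ((f * u / (2 * w * q)) * (f * v / (2 * w * q))) = u * v / (4 * w\<^sup>2 * q\<^sup>2) * (c * (S * (f / F)\<^sup>2))"
      for c S F f u v w q :: real
      by (simp add: power2_eq_square mult_ac)
    from this[of "\<epsilon> ^ j" "real (stirling n (n - j))" "fact n" "fact (n - j)" "E x" pi "sqrt (real n)" "E y"]
    have *: "\<epsilon> ^ j * real (stirling n (n - j)) / (fact n)\<^sup>2 * ((fact (n - j) * E x / (2 * pi * sqrt (real n))) * (fact (n - j) * E y / (2 * pi * sqrt (real n)))) =
      E x * E y / (4 * pi\<^sup>2 * real n) * (\<epsilon> ^ j * stirling_weight n j)"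
      by (simp only: stirling_weight_def real_sqrt_pow2 of_nat_0_le_iff)
    show "of_real (\<epsilon> ^ j * real (stirling n (n - j)) / (fact n)\<^sup>2) * (complex_of_real (irwin_hall n (n - j) (n - a)) * of_real (irwin_hall n (n - j) (n - b))) =
      of_real (E x * E y / (4 * pi\<^sup>2 * real n)) * (of_real (\<epsilon> ^ j * stirling_weight n j) * (K x a j * K y b j))"
      unfolding ih[OF j] by (rule pull[OF *])
  qed
  also have "E x * E y = exp (- real n * rate2 x y + offset n x * tilt x + offset n y * tilt y)"
    by (simp add: E_def rate2_def exp_add[symmetric] algebra_simps)
  finally show ?thesis by (simp only: a_def b_def K_def sum_distrib_left)
qed

lemma tails_asymp_equiv:
  fixes s r :: bool
  assumes x: "x \<in> {1/2<..<1}" and y: "y \<in> {1/2<..<1}"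
  defines "\<epsilon> \<equiv> (if s = r then 1 else - 1 :: real)"
  shows "(\<lambda>n. measure_pmf.prob (uniform_perm n)
      {\<sigma>. in_tail s n (threshold x n) (descents n \<sigma>) \<and> in_tail r n (threshold y n) (descents n (inv \<sigma>))}) \<sim>[at_top]
    (\<lambda>n. exp (- real n * rate2 x y + (offset n x * tilt x + offset n y * tilt y + \<epsilon> * (tilt x * tilt y) / 2)) /
      (2 * pi * real n * tilt_sd x * tilt x * tilt_sd y * tilt y))"
proof (rule asymp_equivI')
  let ?p = "\<lambda>n. measure_pmf.prob (uniform_perm n)
      {\<sigma>. in_tail s n (threshold x n) (descents n \<sigma>) \<and> in_tail r n (threshold y n) (descents n (inv \<sigma>))}"
  let ?q = "\<lambda>n. exp (- real n * rate2 x y + (offset n x * tilt x + offset n y * tilt y + \<epsilon> * (tilt x * tilt y) / 2)) /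
      (2 * pi * real n * tilt_sd x * tilt x * tilt_sd y * tilt y)"
  define K where "K x n j = (\<integral>v. saddle_kernel (tilt x) (real (threshold x n)) n j v \<partial>lborel)" for x n j
  define R where "R n = (\<Sum>j<n. of_real (\<epsilon> ^ j * stirling_weight n j) * (K x n j * K y n j))" for n
  \<comment> \<open>The quotient, free of n, of the prefactor in \<open>prob_tails\<close> by the
    asserted expression; so the claim is that C times the series tends to 1.\<close>
  define C where "C = 2 * pi * tilt_sd x * tilt x * tilt_sd y * tilt y / (4 * pi\<^sup>2 * exp (\<epsilon> * (tilt x * tilt y) / 2))"
  have t: "tilt z > 0" "tilt_sd z > 0" "log_laplace' (tilt z) = z" "sqrt (2 * pi / log_laplace'' (tilt z)) = sqrt (2 * pi) / tilt_sd z"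
    if "z \<in> {1/2<..<1}" for z
    using tilt_properties[OF that] log_laplace''_pos[of "tilt z"] by (auto simp: real_sqrt_divide)
  have Klim: "(\<lambda>n. K z n j) \<longlonglongrightarrow> of_real (sqrt (2 * pi) / tilt_sd z * (tilt z ^ j / tilt z))"
    if z: "z \<in> {1/2<..<1}" for z j
  proof -
    have "real (threshold z n) = real n * log_laplace' (tilt z) - offset n z" for n
      using threshold_properties(1)[OF z, of n] t(3)[OF z] by simp
    then show ?thesis
      unfolding K_def using saddle_integral_tendsto[OF t(1)[OF z], of "\<lambda>n. offset n z" j] threshold_properties(2)[OF z]
      by (simp add: t(4)[OF z])
  qed
  obtain A B where AB: "A \<ge> 0" "B \<ge> 0" "\<And>n j. n \<ge> 2 \<Longrightarrow> j < n \<Longrightarrow> norm (K x n j) \<le> A * B ^ j"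
    using saddle_integral_bound[OF t(1)[OF x]] unfolding K_def by metis
  obtain A' B' where AB': "A' \<ge> 0" "B' \<ge> 0" "\<And>n j. n \<ge> 2 \<Longrightarrow> j < n \<Longrightarrow> norm (K y n j) \<le> A' * B' ^ j"
    using saddle_integral_bound[OF t(1)[OF y]] unfolding K_def by metis
  have R: "R \<longlonglongrightarrow> of_real (sqrt (2 * pi) / tilt_sd x * (sqrt (2 * pi) / tilt_sd y) / (tilt x * tilt y) * exp (\<epsilon> * (tilt x * tilt y) / 2))"
    unfolding R_def by (rule series_tendsto[OF Klim[OF x] Klim[OF y] AB(3,1,2) AB'(3,1,2)]) (auto simp: \<epsilon>_def)
  have "(\<lambda>n. of_real C * R n) \<longlonglongrightarrow> of_real C * of_real (sqrt (2 * pi) / tilt_sd x * (sqrt (2 * pi) / tilt_sd y) / (tilt x * tilt y) * exp (\<epsilon> * (tilt x * tilt y) / 2))"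
    by (intro tendsto_mult tendsto_const R)
  also have "complex_of_real C * of_real (sqrt (2 * pi) / tilt_sd x * (sqrt (2 * pi) / tilt_sd y) / (tilt x * tilt y) * exp (\<epsilon> * (tilt x * tilt y) / 2)) = of_real 1"
  proof -
    have "C * (sqrt (2 * pi) / tilt_sd x * (sqrt (2 * pi) / tilt_sd y) / (tilt x * tilt y) * exp (\<epsilon> * (tilt x * tilt y) / 2)) = (sqrt (2 * pi))\<^sup>2 / (2 * pi)"
      unfolding C_def using t(1,2)[OF x] t(1,2)[OF y] by (simp add: field_simps power2_eq_square)
    also have "\<dots> = 1" by simp
    finally show ?thesis by (simp only: of_real_mult[symmetric])
  qed
  finally have lim: "(\<lambda>n. of_real C * R n) \<longlonglongrightarrow> complex_of_real 1" .
  have "eventually (\<lambda>n. of_real C * R n = complex_of_real (?p n / ?q n)) sequentially"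
    using eventually_ge_at_top[of 2]
  proof eventually_elim
    case (elim n)
    define E where "E = exp (- real n * rate2 x y + offset n x * tilt x + offset n y * tilt y)"
    have p: "complex_of_real (?p n) = of_real (E / (4 * pi\<^sup>2 * real n)) * R n"
      unfolding R_def K_def E_def \<epsilon>_def by (rule prob_tails[OF x y elim])
    have q: "?q n = E * exp (\<epsilon> * (tilt x * tilt y) / 2) / (2 * pi * real n * tilt_sd x * tilt x * tilt_sd y * tilt y)"
      by (simp add: E_def exp_add[symmetric] algebra_simps)
    have "E / (4 * pi\<^sup>2 * real n) / ?q n = C"
      unfolding q C_def using elim t(1,2)[OF x] t(1,2)[OF y] by (simp add: E_def field_simps)
    then show ?case using p by (metis (no_types, lifting) mult.commute of_real_divide times_divide_eq_left)
  qed
  then have "(\<lambda>n. complex_of_real (?p n / ?q n)) \<longlonglongrightarrow> of_real 1"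
    by (rule Lim_transform_eventually[OF lim])
  then show "(\<lambda>n. ?p n / ?q n) \<longlonglongrightarrow> 1" by (simp only: tendsto_of_real_iff)
qed

text \<open>Descent numbers are below n and the asymptotics ignore small n, so the events have to
  agree with the tails only for n \<ge> 2 and d < n.\<close>

lemma tails_asymp_equiv_cong:
  assumes x: "x \<in> {1/2<..<1}" and y: "y \<in> {1/2<..<1}"
    and P: "\<And>n d. n \<ge> 2 \<Longrightarrow> d < n \<Longrightarrow> P n d \<longleftrightarrow> in_tail s n (threshold x n) d"
    and Q: "\<And>n d. n \<ge> 2 \<Longrightarrow> d < n \<Longrightarrow> Q n d \<longleftrightarrow> in_tail r n (threshold y n) d"
    and c: "\<And>n. corr n = offset n x * tilt x + offset n y * tilt y + (if s = r then 1 else - 1) * (tilt x * tilt y) / 2"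
  shows "(\<lambda>n. measure_pmf.prob (uniform_perm n) {\<sigma>. P n (descents n \<sigma>) \<and> Q n (descents n (inv \<sigma>))}) \<sim>[at_top]
    (\<lambda>n. exp (- real n * rate2 x y + corr n) / (2 * pi * real n * tilt_sd x * tilt x * tilt_sd y * tilt y))"
proof -
  have "eventually (\<lambda>n. measure_pmf.prob (uniform_perm n) {\<sigma>. P n (descents n \<sigma>) \<and> Q n (descents n (inv \<sigma>))} =
    measure_pmf.prob (uniform_perm n)
      {\<sigma>. in_tail s n (threshold x n) (descents n \<sigma>) \<and> in_tail r n (threshold y n) (descents n (inv \<sigma>))}) at_top"
    using eventually_ge_at_top[of 2]
  proof eventually_elim
    case (elim n)
    have "descents n \<sigma> < n" for \<sigma> using descents_less[of n \<sigma>] elim by simp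
    then show ?case using P[OF elim] Q[OF elim] by simp
  qed
  then show ?thesis
    by (rule asymp_equiv_cong[THEN iffD2, OF _ _ tails_asymp_equiv[OF x y, of s r]]) (simp add: c)
qed

theorem theorem4p2:
  fixes x y :: real
  assumes "x \<in> {1/2<..<1}" and "y \<in> {1/2<..<1}"
  shows
    "((\<lambda>n. measure_pmf.prob (uniform_perm n)
            {\<sigma>. real (descents n \<sigma>) / (real n - 1) \<ge> x \<and>
                real (descents n (inv \<sigma>)) / (real n - 1) \<ge> y})
          \<sim>[at_top]
         (\<lambda>n. exp (- real n * rate2 x y + corr_pos n x y) /
            (2 * pi * real n * tilt_sd x * tilt x * tilt_sd y * tilt y))) \<and>
     ((\<lambda>n. measure_pmf.prob (uniform_perm n)
            {\<sigma>. real (descents n \<sigma>) / (real n - 1) \<le> 1 - x \<and>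
                real (descents n (inv \<sigma>)) / (real n - 1) \<le> 1 - y})
          \<sim>[at_top]
         (\<lambda>n. exp (- real n * rate2 x y + corr_pos n x y) /
            (2 * pi * real n * tilt_sd x * tilt x * tilt_sd y * tilt y))) \<and>
     ((\<lambda>n. measure_pmf.prob (uniform_perm n)
            {\<sigma>. real (descents n \<sigma>) / (real n - 1) \<le> 1 - x \<and>
                real (descents n (inv \<sigma>)) / (real n - 1) \<ge> y})
          \<sim>[at_top]
         (\<lambda>n. exp (- real n * rate2 x y + corr_neg n x y) /
            (2 * pi * real n * tilt_sd x * tilt x * tilt_sd y * tilt y))) \<and>
     ((\<lambda>n. measure_pmf.prob (uniform_perm n)
            {\<sigma>. real (descents n \<sigma>) / (real n - 1) \<ge> x \<and>
                real (descents n (inv \<sigma>)) / (real n - 1) \<le> 1 - y})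
          \<sim>[at_top]
         (\<lambda>n. exp (- real n * rate2 x y + corr_neg n x y) /
            (2 * pi * real n * tilt_sd x * tilt x * tilt_sd y * tilt y)))"
proof -
  note A = tails_asymp_equiv_cong[OF assms]
  note T = threshold_properties(4,5)[OF assms(1)] threshold_properties(4,5)[OF assms(2)]
  show ?thesis
  proof (intro conjI)
    show "(\<lambda>n. measure_pmf.prob (uniform_perm n)
            {\<sigma>. real (descents n \<sigma>) / (real n - 1) \<ge> x \<and>
                real (descents n (inv \<sigma>)) / (real n - 1) \<ge> y})
          \<sim>[at_top]
         (\<lambda>n. exp (- real n * rate2 x y + corr_pos n x y) /
            (2 * pi * real n * tilt_sd x * tilt x * tilt_sd y * tilt y))"
      by (rule A[where s = True and r = True]) (simp_all add: T corr_pos_def)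
    show "(\<lambda>n. measure_pmf.prob (uniform_perm n)
            {\<sigma>. real (descents n \<sigma>) / (real n - 1) \<le> 1 - x \<and>
                real (descents n (inv \<sigma>)) / (real n - 1) \<le> 1 - y})
          \<sim>[at_top]
         (\<lambda>n. exp (- real n * rate2 x y + corr_pos n x y) /
            (2 * pi * real n * tilt_sd x * tilt x * tilt_sd y * tilt y))"
      by (rule A[where s = False and r = False]) (simp_all add: T corr_pos_def)
    show "(\<lambda>n. measure_pmf.prob (uniform_perm n)
            {\<sigma>. real (descents n \<sigma>) / (real n - 1) \<le> 1 - x \<and>
                real (descents n (inv \<sigma>)) / (real n - 1) \<ge> y})
          \<sim>[at_top]
         (\<lambda>n. exp (- real n * rate2 x y + corr_neg n x y) /
            (2 * pi * real n * tilt_sd x * tilt x * tilt_sd y * tilt y))"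
      by (rule A[where s = False and r = True]) (simp_all add: T corr_neg_def)
    show "(\<lambda>n. measure_pmf.prob (uniform_perm n)
            {\<sigma>. real (descents n \<sigma>) / (real n - 1) \<ge> x \<and>
                real (descents n (inv \<sigma>)) / (real n - 1) \<le> 1 - y})
          \<sim>[at_top]
         (\<lambda>n. exp (- real n * rate2 x y + corr_neg n x y) /
            (2 * pi * real n * tilt_sd x * tilt x * tilt_sd y * tilt y))"
      by (rule A[where s = True and r = False]) (simp_all add: T corr_neg_def)
  qed
qed

end
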